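(* Let $G$ and $H$ be second countable locally compact Hausdorff groupoids with Haar systems $\{\lambda^u\}_{u\in G^{(0)}}$ and $\{\beta^v\}_{v\in H^{(0)}}$ respectively, let $Z$ be a $(G,H)$-equivalence, and let $L=G\sqcup Z\sqcup Z^{\mathrm{op}}\sqcup H$ be its linking groupoid, with unit space $L^{(0)}=G^{(0)}\sqcup H^{(0)}$. For each $w\in L^{(0)}$, let $\kappa^w$ be the Radon measure on $L$ given on $F\in C_c(L)$ by $$\kappa^w(F)=\begin{cases}\lambda^w(F|_G)+\sigma_Z^w(F|_Z)&\text{if } w\in G^{(0)},\\ \sigma_{Z^{\mathrm{op}}}^w(F|_{Z^{\mathrm{op}}})+\beta^w(F|_H)&\text{if } w\in H^{(0)}.\end{cases}$$ Then $\{\kappa^w\}_{w\in L^{(0)}}$ is a Haar system for $L$.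
   Context: All groupoids and spaces are second countable, locally compact and Hausdorff. A Haar system on a groupoid $G$ is a family of Radon measures $\{\lambda^u\}_{u\in G^{(0)}}$ on $G$ with $\operatorname{supp}\lambda^u=G^u=r^{-1}(u)$, with $u\mapsto\int f\,d\lambda^u$ continuous for every $f\in C_c(G)$, and with $\int f(\gamma\eta)\,d\lambda^{s(\gamma)}(\eta)=\int f(\eta)\,d\lambda^{r(\gamma)}(\eta)$ for all $\gamma\in G$, $f\in C_c(G)$ (left invariance). A left $G$-space is a space $Z$ with a continuous open map $r_Z:Z\to G^{(0)}$ and a continuous map $(\gamma,z)\mapsto\gamma\cdot z$ from $\{(\gamma,z):s(\gamma)=r_Z(z)\}$ to $Z$ with $r_Z(z)\cdot z=z$ and $(\gamma\eta)\cdot z=\gamma\cdot(\eta\cdot z)$. The action is free if $\gamma\cdot z=z$ implies $\gamma=r(z)$, and proper if $(\gamma,z)\mapsto(\gamma\cdot z,z)$ is a proper map into $Z\times Z$. Right spaces are defined similarly, with structure map $s_Z$. A $(G,H)$-equivalence is a space $Z$ that is a free and proper left $G$-space and a free and proper right $H$-space, with commuting actions, such that $r_Z$ induces a homeomorphism $Z/H\to G^{(0)}$ and $s_Z$ induces a homeomorphism $G\backslash Z\to H^{(0)}$. For $s(y)=s(z)$, ${}_G[y,z]\in G$ is the unique element with ${}_G[y,z]\cdot z=y$; for $r(y)=r(z)$, $[y,z]_H\in H$ is the unique element with $y\cdot[y,z]_H=z$; both maps are continuous. $Z^{\mathrm{op}}=\{\overline z:z\in Z\}$ is a homeomorphic copy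 of $Z$, an $(H,G)$-equivalence with $r(\overline z)=s(z)$, $s(\overline z)=r(z)$, $\eta\cdot\overline z=\overline{z\cdot\eta^{-1}}$, $\overline z\cdot\gamma=\overline{\gamma^{-1}\cdot z}$. The linking groupoid is the topological disjoint union $L=G\sqcup Z\sqcup Z^{\mathrm{op}}\sqcup H$ with unit space $L^{(0)}=G^{(0)}\sqcup H^{(0)}$, with range and source maps inherited from the pieces, multiplication given by multiplication in $G$ and $H$, the actions of $G$ and $H$ on $Z$ and $Z^{\mathrm{op}}$, $z\overline y={}_G[z,y]$ when $s(z)=s(y)$, and $\overline y z=[y,z]_H$ when $r(y)=r(z)$; inversion is that of $G$ and $H$ together with $z^{-1}=\overline z$, $\overline z^{\,-1}=z$. For $u\in G^{(0)}$, $\sigma_Z^u$ is the Radon measure on $Z$ given by $\sigma_Z^u(\phi)=\int_H\phi(z\cdot\eta)\,d\beta^{s(z)}(\eta)$ for $\phi\in C_c(Z)$ and any $z\in Z$ with $r(z)=u$ (this does not depend on $z$). For $v\in H^{(0)}$, $\sigma_{Z^{\mathrm{op}}}^v$ is the analogous Radon measure on $Z^{\mathrm{op}}$: $\sigma_{Z^{\mathrm{op}}}^v(\psi)=\int_G\psi(\overline z\cdot\gamma)\,d\lambda^{r(z)}(\gamma)$ for $\psi\in C_c(Z^{\mathrm{op}})$ and any $z\in Z$ with $s(z)=v$. *)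

theory Defs
  imports "HOL-Analysis.Analysis"
begin

section \<open>Radon measures\<close>

definition Cc :: "('a::topological_space \<Rightarrow> complex) set" where
  "Cc = {f. continuous_on UNIV f \<and> compact (closure {x. f x \<noteq> 0})}"

definition radon_measure :: "'a::topological_space measure \<Rightarrow> bool" where
  "radon_measure M \<longleftrightarrow>
     sets M = sets borel \<and>
     (\<forall>K. compact K \<longrightarrow> emeasure M K < \<infinity>) \<and>
     (\<forall>B\<in>sets borel. emeasure M B = (INF U\<in>{U. B \<subseteq> U \<and> open U}. emeasure M U)) \<and>
     (\<forall>U. open U \<longrightarrow> emeasure M U = (SUP K\<in>{K. K \<subseteq> U \<and> compact K}. emeasure M K))"

definition msupp :: "'a::topological_space measure \<Rightarrow> 'a set" where
  "msupp M = {x. \<forall>U. open U \<and> x \<in> U \<longrightarrow> emeasure M U > 0}"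

section \<open>Topological groupoids and Haar systems\<close>

text \<open>The underlying space of a groupoid is a whole type. The product \<open>mul G x y\<close> is only
  meaningful if \<open>src G x = rng G y\<close>; likewise for the actions below. The unit space is regarded
  as a subset of the groupoid.\<close>

record 'g groupoid =
  rng :: "'g \<Rightarrow> 'g"
  src :: "'g \<Rightarrow> 'g"
  mul :: "'g \<Rightarrow> 'g \<Rightarrow> 'g"
  ginv :: "'g \<Rightarrow> 'g"

definition units :: "('g, 'm) groupoid_scheme \<Rightarrow> 'g set" where
  "units G = range (rng G)"

definition rfib :: "('g, 'm) groupoid_scheme \<Rightarrow> 'g \<Rightarrow> 'g set" where
  "rfib G u = {x. rng G x = u}"

locale lch_groupoid =
  fixes G :: "'g::{second_countable_topology, t2_space} groupoid"
  assumes rng_rng: "rng G (rng G x) = rng G x"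
    and src_rng: "src G (rng G x) = rng G x"
    and rng_src: "rng G (src G x) = src G x"
    and src_src: "src G (src G x) = src G x"
    and rng_mul: "src G x = rng G y \<Longrightarrow> rng G (mul G x y) = rng G x"
    and src_mul: "src G x = rng G y \<Longrightarrow> src G (mul G x y) = src G y"
    and mul_assoc: "src G x = rng G y \<Longrightarrow> src G y = rng G z \<Longrightarrow>
          mul G (mul G x y) z = mul G x (mul G y z)"
    and mul_unit_left: "mul G (rng G x) x = x"
    and mul_unit_right: "mul G x (src G x) = x"
    and rng_inv: "rng G (ginv G x) = src G x"
    and src_inv: "src G (ginv G x) = rng G x"
    and mul_inv_right: "mul G x (ginv G x) = rng G x"
    and mul_inv_left: "mul G (ginv G x) x = src G x"
    and continuous_mul: "continuous_on {(x, y). src G x = rng G y} (\<lambda>(x, y). mul G x y)"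
    and continuous_inv: "continuous_on UNIV (ginv G)"
    and continuous_rng: "continuous_on UNIV (rng G)"
    and continuous_src: "continuous_on UNIV (src G)"
    and locally_compact: "locally_compact_space (euclidean :: 'g topology)"

text \<open>In the left invariance condition the integrand is only meaningful on the fibre over
  \<open>src G x\<close>, hence the integral over that fibre, whose complement is a null set.\<close>

definition haar_system ::
  "'g::topological_space groupoid \<Rightarrow> ('g \<Rightarrow> 'g measure) \<Rightarrow> bool" where
  "haar_system G \<alpha> \<longleftrightarrow>
     (\<forall>u\<in>units G. radon_measure (\<alpha> u) \<and> msupp (\<alpha> u) = rfib G u) \<and>
     (\<forall>f\<in>Cc. continuous_on (units G) (\<lambda>u. \<integral>x. f x \<partial>\<alpha> u)) \<and>
     (\<forall>x. \<forall>f\<in>Cc.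
        (LINT y:rfib G (src G x)|\<alpha> (src G x). f (mul G x y)) = (\<integral>y. f y \<partial>\<alpha> (rng G x)))"

section \<open>Groupoid spaces and equivalences\<close>

definition left_space ::
  "'g::topological_space groupoid \<Rightarrow> ('z::topological_space \<Rightarrow> 'g) \<Rightarrow> ('g \<Rightarrow> 'z \<Rightarrow> 'z) \<Rightarrow> bool" where
  "left_space G r act \<longleftrightarrow>
     continuous_map euclidean (top_of_set (units G)) r \<and>
     open_map euclidean (top_of_set (units G)) r \<and>
     continuous_on {(x, z). src G x = r z} (\<lambda>(x, z). act x z) \<and>
     (\<forall>x z. src G x = r z \<longrightarrow> r (act x z) = rng G x) \<and>
     (\<forall>z. act (r z) z = z) \<and>
     (\<forall>x y z. src G x = rng G y \<and> src G y = r z \<longrightarrow> act (mul G x y) z = act x (act y z))"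

definition left_free ::
  "'g::topological_space groupoid \<Rightarrow> ('z::topological_space \<Rightarrow> 'g) \<Rightarrow> ('g \<Rightarrow> 'z \<Rightarrow> 'z) \<Rightarrow> bool" where
  "left_free G r act \<longleftrightarrow> (\<forall>x z. src G x = r z \<and> act x z = z \<longrightarrow> x = r z)"

definition left_proper ::
  "'g::topological_space groupoid \<Rightarrow> ('z::topological_space \<Rightarrow> 'g) \<Rightarrow> ('g \<Rightarrow> 'z \<Rightarrow> 'z) \<Rightarrow> bool" where
  "left_proper G r act \<longleftrightarrow>
     proper_map (top_of_set {(x, z). src G x = r z}) euclidean (\<lambda>(x, z). (act x z, z))"

definition right_space ::
  "'h::topological_space groupoid \<Rightarrow> ('z::topological_space \<Rightarrow> 'h) \<Rightarrow> ('z \<Rightarrow> 'h \<Rightarrow> 'z) \<Rightarrow> bool" where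
  "right_space H s act \<longleftrightarrow>
     continuous_map euclidean (top_of_set (units H)) s \<and>
     open_map euclidean (top_of_set (units H)) s \<and>
     continuous_on {(z, x). s z = rng H x} (\<lambda>(z, x). act z x) \<and>
     (\<forall>z x. s z = rng H x \<longrightarrow> s (act z x) = src H x) \<and>
     (\<forall>z. act z (s z) = z) \<and>
     (\<forall>z x y. s z = rng H x \<and> src H x = rng H y \<longrightarrow> act z (mul H x y) = act (act z x) y)"

definition right_free ::
  "'h::topological_space groupoid \<Rightarrow> ('z::topological_space \<Rightarrow> 'h) \<Rightarrow> ('z \<Rightarrow> 'h \<Rightarrow> 'z) \<Rightarrow> bool" where
  "right_free H s act \<longleftrightarrow> (\<forall>z x. s z = rng H x \<and> act z x = z \<longrightarrow> x = s z)"

definition right_proper ::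
  "'h::topological_space groupoid \<Rightarrow> ('z::topological_space \<Rightarrow> 'h) \<Rightarrow> ('z \<Rightarrow> 'h \<Rightarrow> 'z) \<Rightarrow> bool" where
  "right_proper H s act \<longleftrightarrow>
     proper_map (top_of_set {(z, x). s z = rng H x}) euclidean (\<lambda>(z, x). (act z x, z))"

definition left_orbit ::
  "'g groupoid \<Rightarrow> ('z \<Rightarrow> 'g) \<Rightarrow> ('g \<Rightarrow> 'z \<Rightarrow> 'z) \<Rightarrow> 'z \<Rightarrow> 'z set" where
  "left_orbit G r act z = {act x z |x. src G x = r z}"

definition right_orbit ::
  "'h groupoid \<Rightarrow> ('z \<Rightarrow> 'h) \<Rightarrow> ('z \<Rightarrow> 'h \<Rightarrow> 'z) \<Rightarrow> 'z \<Rightarrow> 'z set" where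
  "right_orbit H s act z = {act z x |x. s z = rng H x}"

text \<open>The quotient topology on \<open>range q\<close>; it is used for \<open>q\<close> the map sending a point to
  its orbit.\<close>

definition quotient_topology :: "('z::topological_space \<Rightarrow> 'q) \<Rightarrow> 'q topology" where
  "quotient_topology q = topology (\<lambda>U. U \<subseteq> range q \<and> open (q -` U))"

lemma openin_quotient_topology:
  "openin (quotient_topology q) U \<longleftrightarrow> U \<subseteq> range q \<and> open (q -` U)"
proof -
  have "istopology (\<lambda>U. U \<subseteq> range q \<and> open (q -` U))"
    unfolding istopology_def by (auto simp: vimage_Union)
  then show ?thesis
    by (simp add: quotient_topology_def)
qed

definition induces_homeomorphism ::
  "('z::topological_space \<Rightarrow> 'q) \<Rightarrow> 'a::topological_space set \<Rightarrow> ('z \<Rightarrow> 'a) \<Rightarrow> bool" where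
  "induces_homeomorphism q A f \<longleftrightarrow>
     (\<exists>h. homeomorphic_map (quotient_topology q) (top_of_set A) h \<and> (\<forall>z. h (q z) = f z))"

record ('g, 'z, 'h) bispace =
  rmap :: "'z \<Rightarrow> 'g"
  smap :: "'z \<Rightarrow> 'h"
  lact :: "'g \<Rightarrow> 'z \<Rightarrow> 'z"
  ract :: "'z \<Rightarrow> 'h \<Rightarrow> 'z"

locale groupoid_equivalence =
  G: lch_groupoid G + H: lch_groupoid H
  for G :: "'g::{second_countable_topology, t2_space} groupoid"
    and H :: "'h::{second_countable_topology, t2_space} groupoid" +
  fixes Z :: "('g, 'z::{second_countable_topology, t2_space}, 'h) bispace"
  assumes locally_compact_Z: "locally_compact_space (euclidean :: 'z topology)"
    and left_space: "left_space G (rmap Z) (lact Z)"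
    and left_free: "left_free G (rmap Z) (lact Z)"
    and left_proper: "left_proper G (rmap Z) (lact Z)"
    and right_space: "right_space H (smap Z) (ract Z)"
    and right_free: "right_free H (smap Z) (ract Z)"
    and right_proper: "right_proper H (smap Z) (ract Z)"
    and smap_lact: "src G x = rmap Z z \<Longrightarrow> smap Z (lact Z x z) = smap Z z"
    and rmap_ract: "smap Z z = rng H y \<Longrightarrow> rmap Z (ract Z z y) = rmap Z z"
    and actions_commute: "src G x = rmap Z z \<Longrightarrow> smap Z z = rng H y \<Longrightarrow>
          ract Z (lact Z x z) y = lact Z x (ract Z z y)"
    and rmap_homeo:
      "induces_homeomorphism (right_orbit H (smap Z) (ract Z)) (units G) (rmap Z)"
    and smap_homeo:
      "induces_homeomorphism (left_orbit G (rmap Z) (lact Z)) (units H) (smap Z)"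

definition lbracket :: "'g groupoid \<Rightarrow> ('g, 'z, 'h) bispace \<Rightarrow> 'z \<Rightarrow> 'z \<Rightarrow> 'g" where
  "lbracket G Z y z = (THE x. src G x = rmap Z z \<and> lact Z x z = y)"

definition rbracket :: "'h groupoid \<Rightarrow> ('g, 'z, 'h) bispace \<Rightarrow> 'z \<Rightarrow> 'z \<Rightarrow> 'h" where
  "rbracket H Z y z = (THE x. smap Z y = rng H x \<and> ract Z y x = z)"

section \<open>The opposite space\<close>

datatype 'z opp = Bar (unbar: 'z)

instantiation opp :: (topological_space) topological_space
begin

definition open_opp :: "'a opp set \<Rightarrow> bool" where
  "open_opp U \<longleftrightarrow> open (Bar -` U)"

instance
  by standard (auto simp: open_opp_def vimage_Union)

end

definition opp_space ::
  "'g groupoid \<Rightarrow> 'h groupoid \<Rightarrow> ('g, 'z, 'h) bispace \<Rightarrow> ('h, 'z opp, 'g) bispace" where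
  "opp_space G H Z =
     \<lparr> rmap = (\<lambda>w. smap Z (unbar w)),
       smap = (\<lambda>w. rmap Z (unbar w)),
       lact = (\<lambda>y w. Bar (ract Z (unbar w) (ginv H y))),
       ract = (\<lambda>w x. Bar (lact Z (ginv G x) (unbar w))) \<rparr>"

section \<open>The linking groupoid\<close>

datatype ('g, 'z, 'h) linking = InG 'g | InZ 'z | InOp "'z opp" | InH 'h

instantiation linking ::
  (topological_space, topological_space, topological_space) topological_space
begin

definition open_linking :: "('a, 'b, 'c) linking set \<Rightarrow> bool" where
  "open_linking U \<longleftrightarrow>
     open (InG -` U) \<and> open (InZ -` U) \<and> open (InOp -` U) \<and> open (InH -` U)"

instance
  by standard (auto simp: open_linking_def vimage_Union)

end

fun link_rng :: "'g groupoid \<Rightarrow> 'h groupoid \<Rightarrow> ('g, 'z, 'h) bispace \<Rightarrow>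
    ('g, 'z, 'h) linking \<Rightarrow> ('g, 'z, 'h) linking" where
  "link_rng G H Z (InG x) = InG (rng G x)"
| "link_rng G H Z (InZ z) = InG (rmap Z z)"
| "link_rng G H Z (InOp w) = InH (rmap (opp_space G H Z) w)"
| "link_rng G H Z (InH y) = InH (rng H y)"

fun link_src :: "'g groupoid \<Rightarrow> 'h groupoid \<Rightarrow> ('g, 'z, 'h) bispace \<Rightarrow>
    ('g, 'z, 'h) linking \<Rightarrow> ('g, 'z, 'h) linking" where
  "link_src G H Z (InG x) = InG (src G x)"
| "link_src G H Z (InZ z) = InH (smap Z z)"
| "link_src G H Z (InOp w) = InG (smap (opp_space G H Z) w)"
| "link_src G H Z (InH y) = InH (src H y)"

fun link_mul :: "'g groupoid \<Rightarrow> 'h groupoid \<Rightarrow> ('g, 'z, 'h) bispace \<Rightarrow>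
    ('g, 'z, 'h) linking \<Rightarrow> ('g, 'z, 'h) linking \<Rightarrow> ('g, 'z, 'h) linking" where
  "link_mul G H Z (InG x) (InG x') = InG (mul G x x')"
| "link_mul G H Z (InG x) (InZ z) = InZ (lact Z x z)"
| "link_mul G H Z (InZ z) (InH y) = InZ (ract Z z y)"
| "link_mul G H Z (InZ z) (InOp w) = InG (lbracket G Z z (unbar w))"
| "link_mul G H Z (InOp w) (InZ z) = InH (rbracket H Z (unbar w) z)"
| "link_mul G H Z (InOp w) (InG x) = InOp (ract (opp_space G H Z) w x)"
| "link_mul G H Z (InH y) (InOp w) = InOp (lact (opp_space G H Z) y w)"
| "link_mul G H Z (InH y) (InH y') = InH (mul H y y')"
| "link_mul G H Z _ _ = undefined"

fun link_inv :: "'g groupoid \<Rightarrow> 'h groupoid \<Rightarrow>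
    ('g, 'z, 'h) linking \<Rightarrow> ('g, 'z, 'h) linking" where
  "link_inv G H (InG x) = InG (ginv G x)"
| "link_inv G H (InZ z) = InOp (Bar z)"
| "link_inv G H (InOp w) = InZ (unbar w)"
| "link_inv G H (InH y) = InH (ginv H y)"

definition linking_groupoid :: "'g groupoid \<Rightarrow> 'h groupoid \<Rightarrow> ('g, 'z, 'h) bispace \<Rightarrow>
    ('g, 'z, 'h) linking groupoid" where
  "linking_groupoid G H Z =
     \<lparr> rng = link_rng G H Z, src = link_src G H Z, mul = link_mul G H Z, ginv = link_inv G H \<rparr>"

section \<open>The measures on the linking groupoid\<close>

text \<open>For a \<open>(G, H)\<close>-equivalence \<open>Z\<close> and a Haar system \<open>\<beta>\<close> on \<open>H\<close>, \<open>sigma_measure H Z \<beta> u\<close> is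
  the Radon measure on \<open>Z\<close> attached to a unit \<open>u\<close> of \<open>G\<close>. The one on the opposite space attached
  to a unit of \<open>H\<close> is obtained from the \<open>(H, G)\<close>-equivalence \<open>opp_space G H Z\<close>.\<close>

definition sigma_measure :: "'h::topological_space groupoid \<Rightarrow>
    ('g, 'z::topological_space, 'h) bispace \<Rightarrow> ('h \<Rightarrow> 'h measure) \<Rightarrow> 'g \<Rightarrow> 'z measure" where
  "sigma_measure H Z \<beta> u = (THE M. radon_measure M \<and>
     (\<forall>z. rmap Z z = u \<longrightarrow> (\<forall>f\<in>Cc.
        (\<integral>x. f x \<partial>M) = (LINT y:rfib H (smap Z z)|\<beta> (smap Z z). f (ract Z z y)))))"

fun kappa_functional ::
  "'g::topological_space groupoid \<Rightarrow> 'h::topological_space groupoid \<Rightarrow>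
   ('g, 'z::topological_space, 'h) bispace \<Rightarrow> ('g \<Rightarrow> 'g measure) \<Rightarrow> ('h \<Rightarrow> 'h measure) \<Rightarrow>
   ('g, 'z, 'h) linking \<Rightarrow> (('g, 'z, 'h) linking \<Rightarrow> complex) \<Rightarrow> complex" where
  "kappa_functional G H Z \<alpha> \<beta> (InG u) F =
     (\<integral>x. F (InG x) \<partial>\<alpha> u) + (\<integral>z. F (InZ z) \<partial>sigma_measure H Z \<beta> u)"
| "kappa_functional G H Z \<alpha> \<beta> (InH v) F =
     (\<integral>w. F (InOp w) \<partial>sigma_measure G (opp_space G H Z) \<alpha> v) + (\<integral>y. F (InH y) \<partial>\<beta> v)"
| "kappa_functional G H Z \<alpha> \<beta> _ F = undefined"

definition kappa ::
  "'g::topological_space groupoid \<Rightarrow> 'h::topological_space groupoid \<Rightarrow>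
   ('g, 'z::topological_space, 'h) bispace \<Rightarrow> ('g \<Rightarrow> 'g measure) \<Rightarrow> ('h \<Rightarrow> 'h measure) \<Rightarrow>
   ('g, 'z, 'h) linking \<Rightarrow> ('g, 'z, 'h) linking measure" where
  "kappa G H Z \<alpha> \<beta> w =
     (THE M. radon_measure M \<and> (\<forall>F\<in>Cc. (\<integral>x. F x \<partial>M) = kappa_functional G H Z \<alpha> \<beta> w F))"

end

theory Submission
  imports Defs
begin

text \<open>
  All the content lies in the measures \<open>\<sigma>\<^sup>u\<close> on \<open>Z\<close>. Fix \<open>z\<close> with \<open>r(z) = u\<close>. The action of \<open>H\<close>
  is free and proper and its orbits are the fibres of \<open>r\<close>, so the orbit map \<open>\<eta> \<mapsto> z\<eta>\<close> is a closed
  embedding of \<open>H\<close>'s fibre over \<open>s(z)\<close> onto \<open>r\<^sup>-\<^sup>1(u)\<close> (\<open>orbit_embedding\<close>), and \<open>\<sigma>\<^sup>u\<close> is the image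
  of \<open>\<beta>\<close> under it (\<open>sigma_eq_push\<close>). It follows that \<open>\<sigma>\<^sup>u\<close> is a Radon measure with support
  \<open>r\<^sup>-\<^sup>1(u)\<close>, and that every integral over \<open>r\<^sup>-\<^sup>1(u)\<close>, not only that of a function in \<open>C\<^sub>c(Z)\<close>, can be
  computed on a fibre of \<open>H\<close>.

  Left invariance under an element \<open>x\<close> of the linking groupoid splits into one identity for each of
  the two pieces of the fibre over the source of \<open>x\<close>. When \<open>x\<close> lies in \<open>G\<close> or \<open>H\<close>, one of them is
  the invariance of the given Haar system, and the other says that the two actions commute
  (\<open>sigma_equivariant\<close>). When \<open>x = z\<close> lies in \<open>Z\<close>, the piece in \<open>H\<close> is the definition of \<open>\<sigma>\<close>,
  and the piece in the opposite space reduces to the fact that the bracket undoes the orbit map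
  (\<open>sigma_rbracket\<close>). The case of \<open>x\<close> in the opposite space is symmetric.

  The only analytic step is the continuity of \<open>u \<mapsto> \<sigma>\<^sup>u(f)\<close>. It is proved on \<open>Z\<close>, for
  \<open>z \<mapsto> \<integral> f(z\<eta>) d\<beta>(\<eta>)\<close> (\<open>continuous_orbit_integral\<close>): near \<open>z\<^sub>0\<close> the integrand is, by compactness,
  uniformly close to a fixed function in \<open>C\<^sub>c(H)\<close> that extends \<open>\<eta> \<mapsto> f(z\<^sub>0\<eta>)\<close>, and for that one the
  Haar system of \<open>H\<close> gives continuity. It descends to units because \<open>r\<close> is open.

  Two devices shorten the argument. The measures \<open>\<sigma>\<close> and \<open>\<kappa>\<close> are defined by a description, through
  their integrals; since Radon measures are determined by these (\<open>radon_measure_eqI\<close>), it is enough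
  to exhibit Radon measures with the right integrals, and these are images under closed embeddings
  and sums of such. Moreover, the results on \<open>\<sigma>\<close> rest on \<open>Z\<close> being a free and proper right space whose
  orbits are the fibres of an open map; this also holds for the opposite space, with \<open>G\<close> acting, so they are
  proved once, in the locale \<open>principal_haar_space\<close>, and used twice.
\<close>

section \<open>Functions with compact support\<close>

lemma Hausdorff_euclidean: "Hausdorff_space (euclidean :: 'a::t2_space topology)"
  unfolding Hausdorff_space_def disjnt_def by simp (metis hausdorff)

lemma completely_regular_euclidean:
  assumes "locally_compact_space (euclidean :: 'a::t2_space topology)"
  shows "completely_regular_space (euclidean :: 'a topology)"
  using assms Hausdorff_euclidean locally_compact_regular_imp_completely_regular_space
    locally_compact_Hausdorff_imp_regular_space by blast

lemma compact_relatively_compact_neighbourhood: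
  fixes K :: "'a::t2_space set"
  assumes "locally_compact_space (euclidean :: 'a topology)" and "compact K"
  obtains V L where "open V" "compact L" "K \<subseteq> V" "V \<subseteq> L"
  using assms locally_compact_space_compact_closed_compact[of "euclidean :: 'a topology"] Hausdorff_euclidean
  by (metis compactin_euclidean_iff open_openin)

lemma compact_closure_subset:
  fixes L :: "'a::t2_space set"
  assumes "compact L" "A \<subseteq> L"
  shows "compact (closure A)"
proof -
  have "closure A \<subseteq> L" using assms by (simp add: closure_minimal compact_imp_closed)
  then show ?thesis using assms(1) by (metis closed_closure compact_Int_closed inf.absorb_iff2)
qed

lemma Urysohn_compact_support:
  fixes K :: "'a::t2_space set"
  assumes lc: "locally_compact_space (euclidean :: 'a topology)"
    and K: "compact K" "open U" "K \<subseteq> U"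
  obtains \<rho> :: "'a \<Rightarrow> real" where "continuous_on UNIV \<rho>" "\<And>x. 0 \<le> \<rho> x" "\<And>x. \<rho> x \<le> 1"
    "\<And>x. x \<in> K \<Longrightarrow> \<rho> x = 1" "\<And>x. x \<notin> U \<Longrightarrow> \<rho> x = 0" "compact (closure {x. \<rho> x \<noteq> 0})"
proof -
  obtain V L where V: "open V" "compact L" "K \<subseteq> V" "V \<subseteq> L"
    using compact_relatively_compact_neighbourhood[OF lc K(1)] .
  obtain \<rho> where \<rho>: "continuous_map euclidean (subtopology euclidean {0..1::real}) \<rho>"
      "\<rho> ` (- (U \<inter> V)) \<subseteq> {0}" "\<rho> ` K \<subseteq> {1}"
  proof (rule Urysohn_completely_regular_compact_closed[of 0 1 euclidean K "- (U \<inter> V)"])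
    show "closedin euclidean (- (U \<inter> V))"
      using V K by (metis closed_Compl closed_closedin open_Int)
    show "disjnt K (- (U \<inter> V))" using V K by (auto simp: disjnt_def)
  qed (use completely_regular_euclidean[OF lc] K in auto)
  have r: "0 \<le> \<rho> x \<and> \<rho> x \<le> 1" for x
    using \<rho>(1) by (auto simp: continuous_map_in_subtopology)
  have z: "\<rho> x = 0" if "x \<notin> U \<inter> V" for x using \<rho>(2) that by blast
  show ?thesis
  proof
    show "continuous_on UNIV \<rho>" using \<rho>(1) by (simp add: continuous_map_in_subtopology)
    show "compact (closure {x. \<rho> x \<noteq> 0})"
      using z V by (intro compact_closure_subset[of L]) auto
  qed (use r z \<rho>(3) in auto)
qed

lemma Cc_I:
  fixes f :: "'a::t2_space \<Rightarrow> complex"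
  assumes "continuous_on UNIV f" "compact K" "\<And>x. x \<notin> K \<Longrightarrow> f x = 0"
  shows "f \<in> Cc"
  unfolding Cc_def using assms by (auto intro!: compact_closure_subset[of K])

lemma Cc_measurable: "f \<in> Cc \<Longrightarrow> f \<in> borel_measurable borel"
  by (auto simp: Cc_def intro: borel_measurable_continuous_onI)

lemma Cc_complex_of_real:
  fixes \<rho> :: "'a::t2_space \<Rightarrow> real"
  assumes "continuous_on UNIV \<rho>" "compact (closure {x. \<rho> x \<noteq> 0})"
  shows "(\<lambda>x. complex_of_real (\<rho> x)) \<in> Cc"
  using assms by (auto simp: Cc_def intro!: continuous_intros)

text \<open>
  Functions such as \<open>\<eta> \<mapsto> f(z\<eta>)\<close> live on one fibre only, while continuity and invariance of a Haar
  system speak of functions on the whole groupoid. This extension result bridges the gap.\<close>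

lemma Tietze_compact_support:
  fixes f :: "'a::t2_space \<Rightarrow> complex"
  assumes lc: "locally_compact_space (euclidean :: 'a topology)"
    and S: "closed S" "continuous_on S f" and K: "compact K" "{x\<in>S. f x \<noteq> 0} \<subseteq> K"
  obtains k where "k \<in> Cc" "\<And>x. x \<in> S \<Longrightarrow> k x = f x"
proof -
  obtain V L where V: "open V" "compact L" "K \<subseteq> V" "V \<subseteq> L"
    using compact_relatively_compact_neighbourhood[OF lc K(1)] .
  have cSL: "compact (S \<inter> L)" using S V by (simp add: closed_Int_compact)
  have ext: "\<exists>g. continuous_on UNIV g \<and> (\<forall>x\<in>S \<inter> L. g x = h x)"
    if h: "continuous_on S h" for h :: "'a \<Rightarrow> real"
  proof -
    have "continuous_map (top_of_set (S \<inter> L)) euclidean h"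
      using h continuous_on_subset by fastforce
    then obtain g where "continuous_map euclidean euclideanreal g" "\<And>x. x \<in> S \<inter> L \<Longrightarrow> g x = h x"
      using Tietze_extension_completely_regular[OF completely_regular_euclidean[OF lc], of "S \<inter> L" UNIV h]
        cSL by (metis UNIV_not_empty compactin_euclidean_iff is_interval_univ subset_UNIV)
    then show ?thesis by (metis continuous_map_iff_continuous2)
  qed
  obtain g1 where g1: "continuous_on UNIV g1" "\<And>x. x \<in> S \<inter> L \<Longrightarrow> g1 x = Re (f x)"
    using ext[of "\<lambda>x. Re (f x)"] S by (auto intro: continuous_intros)
  obtain g2 where g2: "continuous_on UNIV g2" "\<And>x. x \<in> S \<inter> L \<Longrightarrow> g2 x = Im (f x)"
    using ext[of "\<lambda>x. Im (f x)"] S by (auto intro: continuous_intros)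
  obtain \<rho> :: "'a \<Rightarrow> real" where \<rho>: "continuous_on UNIV \<rho>" "\<And>x. x \<in> K \<Longrightarrow> \<rho> x = 1" "\<And>x. x \<notin> V \<Longrightarrow> \<rho> x = 0"
    using Urysohn_compact_support[OF lc K(1) V(1,3)] by metis
  \<comment> \<open>The extension \<open>g1 + i g2\<close> is only controlled on \<open>S \<inter> L\<close>; the cutoff \<open>\<rho>\<close> kills it off \<open>V \<subseteq> L\<close>
    and does not change it where \<open>f\<close> is nonzero.\<close>
  define k where "k x = complex_of_real (\<rho> x) * Complex (g1 x) (g2 x)" for x
  show ?thesis
  proof
    show "k \<in> Cc"
    proof (rule Cc_I[OF _ V(2)])
      show "continuous_on UNIV k" unfolding k_def complex_eq using \<rho> g1 g2
        by (intro continuous_intros) auto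
      show "k x = 0" if "x \<notin> L" for x using that V \<rho>(3)[of x] by (auto simp: k_def)
    qed
    fix x assume x: "x \<in> S"
    show "k x = f x"
    proof (cases "x \<in> V")
      case True
      then have "Complex (g1 x) (g2 x) = f x" using x V g1 g2 by (simp add: subset_iff)
      then show ?thesis using \<rho>(2)[of x] K(2) x by (auto simp: k_def)
    next
      case False
      then show ?thesis using \<rho>(3) K(2) V(3) x by (auto simp: k_def)
    qed
  qed
qed

section \<open>Radon measures\<close>

lemma radon_sets: "radon_measure M \<Longrightarrow> sets M = sets borel"
  by (simp add: radon_measure_def)

lemma radon_compact_finite: "radon_measure M \<Longrightarrow> compact K \<Longrightarrow> emeasure M K < \<infinity>"
  by (simp add: radon_measure_def)

lemma radon_open_eq:
  "radon_measure M \<Longrightarrow> open U \<Longrightarrow> emeasure M U = (SUP K\<in>{K. K \<subseteq> U \<and> compact K}. emeasure M K)"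
  unfolding radon_measure_def by blast

lemma radon_borel_eq:
  "radon_measure M \<Longrightarrow> B \<in> sets borel \<Longrightarrow> emeasure M B = (INF U\<in>{U. B \<subseteq> U \<and> open U}. emeasure M U)"
  unfolding radon_measure_def by blast

lemma set_integrable_compact_support:
  fixes f :: "'a::t2_space \<Rightarrow> complex"
  assumes M: "radon_measure M" and S: "closed S" "continuous_on S f"
    and K: "compact K" "{x\<in>S. f x \<noteq> 0} \<subseteq> K"
  shows "set_integrable M S f"
proof -
  have "compact (f ` (S \<inter> K))"
    using S K by (intro compact_continuous_image) (auto intro: continuous_on_subset closed_Int_compact)
  then obtain B where B: "\<And>x. x \<in> S \<inter> K \<Longrightarrow> norm (f x) \<le> B"
    by (metis bounded_iff compact_imp_bounded imageI)
  note sM[measurable_cong] = radon_sets[OF M]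
  have "K \<in> sets M" using K sM by (simp add: compact_imp_closed)
  moreover have "(\<lambda>x. indicator S x *\<^sub>R f x) \<in> borel_measurable M"
    using borel_measurable_continuous_on_indicator[OF _ S(2)] S(1) measurable_cong_sets[OF sM refl] by auto
  moreover have "norm (indicator S x *\<^sub>R f x) \<le> \<bar>B\<bar>" if "x \<in> K" for x
    using B[of x] that by (cases "x \<in> S") auto
  moreover have "indicator S x *\<^sub>R f x = 0" if "x \<notin> K" for x
    using K(2) that by (cases "x \<in> S") auto
  ultimately show ?thesis unfolding set_integrable_def
    using radon_compact_finite[OF M K(1)]
    by (intro integrableI_bounded_set[where A=K and B="\<bar>B\<bar>"]) auto
qed

lemma Cc_integrable:
  assumes "radon_measure (M :: 'a::t2_space measure)" "f \<in> Cc"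
  shows "integrable M f"
proof -
  have "set_integrable M UNIV f"
    using assms(2) closure_subset[of "{x. f x \<noteq> 0}"]
    by (intro set_integrable_compact_support[OF assms(1), where K = "closure {x. f x \<noteq> 0}"]) (auto simp: Cc_def)
  then show ?thesis by (simp add: set_integrable_def)
qed

text \<open>
  Half of the uniqueness theorem below: a cutoff function separates \<open>K\<close> from the complement of \<open>U\<close>,
  and its integral, which the two measures share, lies between the two masses.\<close>

lemma radon_compact_le_open:
  fixes M N :: "'a::t2_space measure"
  assumes lc: "locally_compact_space (euclidean :: 'a topology)"
    and M: "radon_measure M" and N: "radon_measure N"
    and eq: "\<And>f. f \<in> Cc \<Longrightarrow> (\<integral>x. f x \<partial>M) = (\<integral>x. f x \<partial>N)"
    and K: "compact K" "open U" "K \<subseteq> U"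
  shows "emeasure M K \<le> emeasure N U"
proof -
  obtain \<rho> :: "'a \<Rightarrow> real" where \<rho>: "continuous_on UNIV \<rho>" "\<And>x. 0 \<le> \<rho> x" "\<And>x. \<rho> x \<le> 1"
    "\<And>x. x \<in> K \<Longrightarrow> \<rho> x = 1" "\<And>x. x \<notin> U \<Longrightarrow> \<rho> x = 0" "compact (closure {x. \<rho> x \<noteq> 0})"
    using Urysohn_compact_support[OF lc K] by metis
  note Cc = Cc_complex_of_real[OF \<rho>(1,6)]
  have int: "integrable M \<rho>" "integrable N \<rho>"
    using Cc_integrable[OF M Cc] Cc_integrable[OF N Cc] by (simp_all add: complex_of_real_integrable_eq)
  have "emeasure M K = (\<integral>\<^sup>+ x. indicator K x \<partial>M)"
    using K radon_sets[OF M] by (simp add: compact_imp_closed)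
  also have "\<dots> \<le> (\<integral>\<^sup>+ x. ennreal (\<rho> x) \<partial>M)"
    using \<rho> by (intro nn_integral_mono) (auto simp: indicator_def)
  also have "\<dots> = ennreal (\<integral>x. \<rho> x \<partial>M)"
    using int \<rho> by (simp add: nn_integral_eq_integral)
  also have "(\<integral>x. \<rho> x \<partial>M) = (\<integral>x. \<rho> x \<partial>N)"
    using eq[OF Cc] by (simp add: integral_complex_of_real)
  also have "ennreal \<dots> = (\<integral>\<^sup>+ x. ennreal (\<rho> x) \<partial>N)"
    using int \<rho> by (simp add: nn_integral_eq_integral)
  also have "\<dots> \<le> (\<integral>\<^sup>+ x. indicator U x \<partial>N)"
    using \<rho> by (intro nn_integral_mono) (auto simp: indicator_def)
  also have "\<dots> = emeasure N U"
    using K radon_sets[OF N] by simp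
  finally show ?thesis .
qed

text \<open>
  The two measures agree on open sets by inner regularity and the preceding estimate, and then on
  Borel sets by outer regularity.\<close>

lemma radon_measure_eqI:
  fixes M N :: "'a::t2_space measure"
  assumes lc: "locally_compact_space (euclidean :: 'a topology)"
    and M: "radon_measure M" and N: "radon_measure N"
    and eq: "\<And>f. f \<in> Cc \<Longrightarrow> (\<integral>x. f x \<partial>M) = (\<integral>x. f x \<partial>N)"
  shows "M = N"
proof -
  have le: "emeasure M U \<le> emeasure N U"
    if "radon_measure M" "radon_measure N" "\<And>f. f \<in> Cc \<Longrightarrow> (\<integral>x. f x \<partial>M) = (\<integral>x. f x \<partial>N)" "open U"
    for M N :: "'a measure" and U
  proof -
    have "emeasure M U = (SUP K\<in>{K. K \<subseteq> U \<and> compact K}. emeasure M K)"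
      by (rule radon_open_eq[OF that(1,4)])
    also have "\<dots> \<le> emeasure N U"
      using radon_compact_le_open[OF lc that(1,2,3)] that(4) by (intro SUP_least) auto
    finally show ?thesis .
  qed
  have op: "emeasure M U = emeasure N U" if "open U" for U
    using le[OF M N eq that] le[OF N M eq[symmetric] that] by simp
  show ?thesis
  proof (rule measure_eqI)
    show "sets M = sets N" using M N by (simp add: radon_sets)
    fix B assume "B \<in> sets M"
    then have B: "B \<in> sets borel" using M by (simp add: radon_sets)
    have "emeasure M B = (INF U\<in>{U. B \<subseteq> U \<and> open U}. emeasure M U)"
      by (rule radon_borel_eq[OF M B])
    also have "\<dots> = (INF U\<in>{U. B \<subseteq> U \<and> open U}. emeasure N U)"
      using op by (intro INF_cong) auto
    also have "\<dots> = emeasure N B"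
      by (rule radon_borel_eq[OF N B, symmetric])
    finally show "emeasure M B = emeasure N B" .
  qed
qed

text \<open>
  The complement of the support is a union of open null sets, and by second countability
  countably many of them suffice.\<close>

lemma emeasure_compl_support:
  fixes M :: "'a::second_countable_topology measure"
  assumes "sets M = sets borel" "msupp M \<subseteq> S" "closed S"
  shows "emeasure M (- S) = 0"
proof -
  define N where "N = {U. open U \<and> emeasure M U = 0}"
  have N: "\<And>U. U \<in> N \<Longrightarrow> open U" by (simp add: N_def)
  obtain N' where N': "N' \<subseteq> N" "countable N'" "\<Union>N' = \<Union>N"
    using Lindelof[OF N] by blast
  have "(\<Union>U\<in>N'. U) \<in> null_sets M"
    using N' by (intro null_sets_UN') (auto simp: null_sets_def N_def assms(1))
  moreover have "- S \<subseteq> \<Union>N"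
  proof
    fix x assume "x \<in> - S"
    then have "x \<notin> msupp M" using assms(2) by auto
    then show "x \<in> \<Union>N" by (auto simp: msupp_def N_def)
  qed
  ultimately show ?thesis
    using N' emeasure_mono[of "- S" "\<Union>N'" M] by (auto simp: null_sets_def)
qed

lemma set_lebesgue_integral_full:
  fixes f :: "'a::topological_space \<Rightarrow> complex"
  assumes "sets M = sets borel" "emeasure M (- S) = 0" "closed S"
    "f \<in> borel_measurable borel"
  shows "(LINT x:S|M. f x) = (\<integral>x. f x \<partial>M)"
proof -
  note [measurable_cong] = assms(1)
  have [measurable]: "f \<in> borel_measurable M" using assms by measurable
  have [measurable]: "S \<in> sets M" using assms by simp
  have "- S \<in> null_sets M" using assms by (auto simp: null_sets_def)
  then have "AE x in M. x \<in> S" using AE_not_in by fastforce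
  then show ?thesis unfolding set_lebesgue_integral_def
    by (intro integral_cong_AE) (auto simp: indicator_def)
qed

section \<open>Sums of measures\<close>

definition add_measure :: "'a measure \<Rightarrow> 'a measure \<Rightarrow> 'a measure" where
  "add_measure M N = measure_of (space M) (sets M) (\<lambda>A. emeasure M A + emeasure N A)"

lemma sets_add_measure [simp, measurable_cong]: "sets (add_measure M N) = sets M"
  by (simp add: add_measure_def)

lemma space_add_measure [simp]: "space (add_measure M N) = space M"
  by (simp add: add_measure_def)

lemma emeasure_add_measure:
  assumes "sets M = sets N" "A \<in> sets M"
  shows "emeasure (add_measure M N) A = emeasure M A + emeasure N A"
proof (rule emeasure_measure_of[OF add_measure_def])
  show "sets M \<subseteq> Pow (space M)" by (rule sets.space_closed)
  show "countably_additive (sets (add_measure M N)) (\<lambda>A. emeasure M A + emeasure N A)"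
  proof (rule countably_additiveI)
    fix A :: "nat \<Rightarrow> 'a set"
    assume A: "range A \<subseteq> sets (add_measure M N)" "disjoint_family A"
    then show "(\<Sum>i. emeasure M (A i) + emeasure N (A i)) = emeasure M (\<Union> (range A)) + emeasure N (\<Union> (range A))"
      using assms(1) by (subst suminf_add[symmetric]) (auto simp: suminf_emeasure)
  qed
qed (use assms in \<open>auto simp: positive_def\<close>)

lemma nn_integral_add_measure:
  assumes "sets M = sets N" "f \<in> borel_measurable M"
  shows "(\<integral>\<^sup>+ x. f x \<partial>add_measure M N) = (\<integral>\<^sup>+ x. f x \<partial>M) + (\<integral>\<^sup>+ x. f x \<partial>N)"
  using assms(2)
proof (induction rule: borel_measurable_induct)
  case (cong f g)
  then show ?case
    by (metis nn_integral_cong sets_eq_imp_space_eq assms(1) space_add_measure)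
next
  case (set A)
  then show ?case using assms(1) by (simp add: emeasure_add_measure)
next
  case (mult u c)
  then have "u \<in> borel_measurable N"
    using measurable_cong_sets[OF assms(1) refl] by blast
  with mult show ?case
    by (simp add: nn_integral_cmult distrib_left)
next
  case (add u v)
  then have "u \<in> borel_measurable N" "v \<in> borel_measurable N"
    using measurable_cong_sets[OF assms(1) refl] by blast+
  with add show ?case
    by (simp add: nn_integral_add ac_simps)
next
  case (seq U)
  have mN: "U i \<in> borel_measurable N" for i
    using seq(1) measurable_cong_sets[OF assms(1) refl] by blast
  have "(\<integral>\<^sup>+ x. (SUP i. U i x) \<partial>add_measure M N) = (SUP i. (\<integral>\<^sup>+ x. U i x \<partial>M) + (\<integral>\<^sup>+ x. U i x \<partial>N))"
    using seq by (simp add: nn_integral_monotone_convergence_SUP)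
  also have "\<dots> = (\<integral>\<^sup>+ x. (SUP i. U i x) \<partial>M) + (\<integral>\<^sup>+ x. (SUP i. U i x) \<partial>N)"
    using seq mN
    by (subst ennreal_SUP_add)
      (auto simp: nn_integral_monotone_convergence_SUP incseq_def le_fun_def intro!: nn_integral_mono)
  finally show ?case by (simp add: image_comp)
qed

lemma integral_add_measure:
  fixes f :: "'a \<Rightarrow> 'b::{banach, second_countable_topology}"
  assumes s: "sets M = sets N" and M: "integrable M f" and N: "integrable N f"
  shows "integrable (add_measure M N) f"
    and "(\<integral>x. f x \<partial>add_measure M N) = (\<integral>x. f x \<partial>M) + (\<integral>x. f x \<partial>N)"
proof -
  have iff: "integrable (add_measure M N) g \<longleftrightarrow> integrable M g \<and> integrable N g" for g :: "'a \<Rightarrow> 'b"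
  proof (cases "g \<in> borel_measurable M")
    case True
    then have "g \<in> borel_measurable N" "g \<in> borel_measurable (add_measure M N)"
      using measurable_cong_sets[OF s refl] measurable_cong_sets[OF sets_add_measure refl] by blast+
    with True show ?thesis
      by (simp add: integrable_iff_bounded nn_integral_add_measure[OF s])
  next
    case False
    then have "g \<notin> borel_measurable (add_measure M N)"
      using measurable_cong_sets[OF sets_add_measure refl] by blast
    with False show ?thesis by (simp add: integrable_iff_bounded)
  qed
  then show int: "integrable (add_measure M N) f" using M N by simp
  then show "(\<integral>x. f x \<partial>add_measure M N) = (\<integral>x. f x \<partial>M) + (\<integral>x. f x \<partial>N)"
  proof induction
    case (base A c)
    then have "emeasure M A < \<infinity>" "emeasure N A < \<infinity>"
      using emeasure_add_measure[OF s, of A] by (auto simp: less_top[symmetric])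
    then have "measure (add_measure M N) A = measure M A + measure N A"
      using base emeasure_add_measure[OF s, of A] by (simp add: measure_def enn2real_plus)
    moreover have "A \<in> sets M" "A \<in> sets N" "emeasure M A < \<infinity>" "emeasure N A < \<infinity>"
      using base emeasure_add_measure[OF s, of A] s by auto
    ultimately show ?case
      using base s by (simp add: scaleR_add_left less_top)
  next
    case (add f g)
    then show ?case using iff by simp
  next
    case (lim f u)
    then have fMN: "integrable M f" "integrable N f" using iff by auto
    have uM: "\<And>i. u i \<in> borel_measurable M" "\<And>i. u i \<in> borel_measurable N"
      using lim(1) iff borel_measurable_integrable by blast+
    have sp: "space N = space M" using s sets_eq_imp_space_eq by metis
    have A: "(\<lambda>i. \<integral>x. u i x \<partial>M) \<longlonglongrightarrow> (\<integral>x. f x \<partial>M)"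
      by (rule integral_dominated_convergence[where w="\<lambda>x. 2 * norm (f x)"])
        (use lim fMN uM sp in auto)
    have B: "(\<lambda>i. \<integral>x. u i x \<partial>N) \<longlonglongrightarrow> (\<integral>x. f x \<partial>N)"
      by (rule integral_dominated_convergence[where w="\<lambda>x. 2 * norm (f x)"])
        (use lim fMN uM sp in auto)
    have C: "(\<lambda>i. \<integral>x. u i x \<partial>add_measure M N) \<longlonglongrightarrow> (\<integral>x. f x \<partial>add_measure M N)"
      by (rule integral_dominated_convergence[where w="\<lambda>x. 2 * norm (f x)"])
        (use lim in auto)
    show ?case
      using tendsto_add[OF A B] C lim(2,5) LIMSEQ_unique by (simp add: lim)
  qed
qed

text \<open>
  Both regularity conditions pass to the sum because open neighbourhoods are closed under
  intersection and compact subsets under union: approximations chosen for each summand can be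
  replaced by a common one.\<close>

lemma radon_add_measure:
  fixes M N :: "'a::t2_space measure"
  assumes M: "radon_measure M" and N: "radon_measure N"
  shows "radon_measure (add_measure M N)"
proof -
  have s: "sets M = sets N" using M N by (simp add: radon_sets)
  have em: "emeasure (add_measure M N) A = emeasure M A + emeasure N A" if "A \<in> sets borel" for A
    using emeasure_add_measure[OF s] that M by (simp add: radon_sets)
  have mono: "A \<subseteq> B \<Longrightarrow> B \<in> sets borel \<Longrightarrow> emeasure M A \<le> emeasure M B \<and> emeasure N A \<le> emeasure N B" for A B
    using M N by (simp add: emeasure_mono radon_sets)
  show ?thesis
    unfolding radon_measure_def
  proof (intro conjI ballI allI impI)
    show "sets (add_measure M N) = sets borel" using M by (simp add: radon_sets)
    show "emeasure (add_measure M N) K < \<infinity>" if "compact K" for K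
      using that radon_compact_finite[OF M that] radon_compact_finite[OF N that] em[of K]
      by (simp add: compact_imp_closed)
  next
    fix B :: "'a set" assume B: "B \<in> sets borel"
    show "emeasure (add_measure M N) B = (INF U\<in>{U. B \<subseteq> U \<and> open U}. emeasure (add_measure M N) U)"
    proof (rule antisym)
      show "emeasure (add_measure M N) B \<le> (INF U\<in>{U. B \<subseteq> U \<and> open U}. emeasure (add_measure M N) U)"
        using M by (intro INF_greatest emeasure_mono) (auto simp: radon_sets)
      show "(INF U\<in>{U. B \<subseteq> U \<and> open U}. emeasure (add_measure M N) U) \<le> emeasure (add_measure M N) B"
      proof (rule ennreal_le_epsilon)
        fix e :: real assume fin: "emeasure (add_measure M N) B < top" and e: "0 < e"
        have ex: "\<exists>U. B \<subseteq> U \<and> open U \<and> emeasure P U \<le> emeasure P B + ennreal (e/2)"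
          if P: "radon_measure P" and f: "emeasure P B < top" for P
        proof -
          have "emeasure P B = (INF U\<in>{U. B \<subseteq> U \<and> open U}. emeasure P U)"
            by (rule radon_borel_eq[OF P B])
          moreover have "emeasure P B < emeasure P B + ennreal (e/2)"
            using f e by simp
          ultimately obtain U where "U \<in> {U. B \<subseteq> U \<and> open U}" "emeasure P U < emeasure P B + ennreal (e/2)"
            by (metis (no_types, lifting) INF_less_iff)
          then show ?thesis by (auto intro: less_imp_le)
        qed
        obtain U where U: "B \<subseteq> U" "open U" "emeasure M U \<le> emeasure M B + ennreal (e/2)"
          using ex[OF M] fin em[OF B] by auto
        obtain V where V: "B \<subseteq> V" "open V" "emeasure N V \<le> emeasure N B + ennreal (e/2)"
          using ex[OF N] fin em[OF B] by auto
        have "(INF U\<in>{U. B \<subseteq> U \<and> open U}. emeasure (add_measure M N) U) \<le> emeasure (add_measure M N) (U \<inter> V)"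
          using U V by (intro INF_lower) (auto intro: open_Int)
        also have "\<dots> \<le> emeasure M U + emeasure N V"
          using U V em[of "U \<inter> V"] mono[of "U \<inter> V" U] mono[of "U \<inter> V" V]
          by (auto simp: open_Int intro!: add_mono)
        also have "\<dots> \<le> (emeasure M B + ennreal (e/2)) + (emeasure N B + ennreal (e/2))"
          using U V by (intro add_mono)
        also have "\<dots> = emeasure (add_measure M N) B + (ennreal (e/2) + ennreal (e/2))"
          using em[OF B] by (simp add: ac_simps)
        also have "ennreal (e/2) + ennreal (e/2) = ennreal e"
          using e by (simp flip: ennreal_plus)
        finally show "(INF U\<in>{U. B \<subseteq> U \<and> open U}. emeasure (add_measure M N) U) \<le> emeasure (add_measure M N) B + ennreal e" .
      qed
    qed
  next
    fix U :: "'a set" assume U: "open U"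
    let ?K = "{K. K \<subseteq> U \<and> compact K}"
    show "emeasure (add_measure M N) U = (SUP K\<in>?K. emeasure (add_measure M N) K)"
    proof (rule antisym)
      show "(SUP K\<in>?K. emeasure (add_measure M N) K) \<le> emeasure (add_measure M N) U"
        using M U by (intro SUP_least emeasure_mono) (auto simp: radon_sets)
      have ne: "?K \<noteq> {}" by (auto intro: exI[of _ "{}"])
      have "emeasure (add_measure M N) U = (SUP K\<in>?K. emeasure M K) + (SUP K\<in>?K. emeasure N K)"
        using em[of U] U radon_open_eq[OF M U] radon_open_eq[OF N U] by simp
      also have "\<dots> = (SUP K\<in>?K. SUP K'\<in>?K. emeasure M K + emeasure N K')"
        by (simp only: ennreal_SUP_add_left[OF ne] ennreal_SUP_add_right[OF ne, symmetric])
      also have "\<dots> \<le> (SUP K\<in>?K. emeasure (add_measure M N) K)"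
      proof (intro SUP_least)
        fix K K' assume K: "K \<in> ?K" "K' \<in> ?K"
        have "emeasure M K + emeasure N K' \<le> emeasure (add_measure M N) (K \<union> K')"
          using K em[of "K \<union> K'"] mono[of K "K \<union> K'"] mono[of K' "K \<union> K'"]
          by (auto simp: compact_imp_closed intro!: add_mono)
        also have "\<dots> \<le> (SUP K\<in>?K. emeasure (add_measure M N) K)"
          using K by (intro SUP_upper) (auto intro: compact_Un)
        finally show "emeasure M K + emeasure N K' \<le> (SUP K\<in>?K. emeasure (add_measure M N) K)" .
      qed
      finally show "emeasure (add_measure M N) U \<le> (SUP K\<in>?K. emeasure (add_measure M N) K)" .
    qed
  qed
qed

lemma msupp_add_measure:
  assumes "sets M = sets borel" "sets N = sets borel"
  shows "msupp (add_measure M N) = msupp M \<union> msupp N"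
proof -
  have em: "emeasure (add_measure M N) U = emeasure M U + emeasure N U" if "open U" for U
    using emeasure_add_measure[of M N U] assms that by simp
  have mono: "emeasure M (U \<inter> V) \<le> emeasure M U \<and> emeasure N (U \<inter> V) \<le> emeasure N V"
    if "open U" "open V" for U V
    using emeasure_mono[of "U \<inter> V" U M] emeasure_mono[of "U \<inter> V" V N] assms that by simp
  show ?thesis
  proof (intro set_eqI iffI)
    fix x assume x: "x \<in> msupp (add_measure M N)"
    show "x \<in> msupp M \<union> msupp N"
    proof (rule ccontr)
      assume "x \<notin> msupp M \<union> msupp N"
      then obtain U V where "open U" "x \<in> U" "emeasure M U = 0" "open V" "x \<in> V" "emeasure N V = 0"
        by (auto simp: msupp_def)
      then have "open (U \<inter> V)" "x \<in> U \<inter> V" "emeasure (add_measure M N) (U \<inter> V) = 0"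
        using em[of "U \<inter> V"] mono[of U V] by (auto simp: open_Int)
      moreover have "0 < emeasure (add_measure M N) W" if "open W" "x \<in> W" for W
        using x that unfolding msupp_def by blast
      ultimately show False by fastforce
    qed
  next
    fix x assume "x \<in> msupp M \<union> msupp N"
    then show "x \<in> msupp (add_measure M N)"
      unfolding msupp_def using em by (auto simp: add_pos_nonneg add_nonneg_pos)
  qed
qed

section \<open>Closed embeddings\<close>

text \<open>
  The inverse is fixed as \<open>inv_into S f\<close> so that
  it can be named without an existential quantifier.\<close>

definition closed_embedding :: "'a::topological_space set \<Rightarrow> ('a \<Rightarrow> 'b::topological_space) \<Rightarrow> bool" where
  "closed_embedding S f \<longleftrightarrow>
     closed S \<and> closed (f ` S) \<and> homeomorphism S (f ` S) f (inv_into S f)"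

lemma closed_embeddingD:
  assumes "closed_embedding S f"
  shows "closed S" "closed (f ` S)" "continuous_on S f" "continuous_on (f ` S) (inv_into S f)" "inj_on f S"
  using assms by (auto simp: closed_embedding_def homeomorphism_def intro: inj_on_inverseI)

lemma closed_embeddingI_inverse:
  assumes "closed S" "closed (f ` S)" "continuous_on S f" "continuous_on (f ` S) g"
    and inv: "\<And>x. x \<in> S \<Longrightarrow> g (f x) = x"
  shows "closed_embedding S f"
proof -
  have inj: "inj_on f S" using inv by (rule inj_on_inverseI)
  have "continuous_on (f ` S) (inv_into S f)"
    by (rule continuous_on_eq[OF assms(4)]) (use inv inj in auto)
  with assms inj show ?thesis
    by (auto simp: closed_embedding_def homeomorphism_def image_image)
qed

lemma closed_embeddingI:
  assumes S: "closed S" "continuous_on S f" "inj_on f S"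
    and cl: "\<And>C. closed C \<Longrightarrow> C \<subseteq> S \<Longrightarrow> closed (f ` C)"
  shows "closed_embedding S f"
proof -
  have "continuous_on (f ` S) (inv_into S f)"
    by (rule continuous_on_inverse_closed_map[OF S(2) refl])
      (use S cl in \<open>auto simp: closedin_closed_eq intro!: closed_subset\<close>)
  then show ?thesis
    using S cl[OF S(1)] by (intro closed_embeddingI_inverse[where g = "inv_into S f"]) auto
qed

lemma closed_embedding_inverse:
  assumes f: "closed_embedding S f" and g: "\<And>x. x \<in> S \<Longrightarrow> g (f x) = x"
  shows "closed_embedding (f ` S) g"
proof -
  note D = closed_embeddingD[OF f]
  have im: "g ` f ` S = S" using g by force
  have "continuous_on (f ` S) g"
    by (rule continuous_on_eq[OF D(4)]) (use D(5) g in auto)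
  then show ?thesis
    using D g im by (intro closed_embeddingI_inverse[where g = f]) auto
qed

lemma compact_closed_embedding_vimage:
  assumes f: "closed_embedding S f" and K: "compact K"
  shows "compact {x\<in>S. f x \<in> K}"
proof -
  note D = closed_embeddingD[OF f]
  have "compact (inv_into S f ` (f ` S \<inter> K))"
    using D K by (intro compact_continuous_image closed_Int_compact) (auto intro: continuous_on_subset)
  moreover have "inv_into S f ` (f ` S \<inter> K) = {x\<in>S. f x \<in> K}"
    using D(5) by (force simp: image_iff)
  ultimately show ?thesis by simp
qed

lemma closed_embedding_image_closed:
  assumes f: "closed_embedding S f" and C: "closed C" "C \<subseteq> S"
  shows "closed (f ` C)"
proof -
  note D = closed_embeddingD[OF f]
  have "f ` C = f ` S \<inter> inv_into S f -` C"
    using D(5) C by (force simp: image_iff)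
  then show ?thesis
    using continuous_closed_preimage[OF D(4,2) C(1)] by simp
qed

lemma closed_embedding_subset:
  assumes f: "closed_embedding S f" and T: "closed T" "T \<subseteq> S"
  shows "closed_embedding T f"
  using closed_embeddingD[OF f] T closed_embedding_image_closed[OF f]
  by (intro closed_embeddingI) (auto intro: continuous_on_subset inj_on_subset)

lemma continuous_on_closed_embedding_image:
  assumes f: "closed_embedding S f" and h: "continuous_on S (\<lambda>x. h (f x))"
  shows "continuous_on (f ` S) h"
proof -
  note D = closed_embeddingD[OF f]
  have "continuous_on (f ` S) (\<lambda>y. h (f (inv_into S f y)))"
    by (rule continuous_on_compose2[OF h D(4)]) (auto intro: inv_into_into)
  then show ?thesis
    by (rule continuous_on_eq) (auto simp: f_inv_into_f)
qed

lemma continuous_on_image_Un: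
  assumes i: "closed_embedding UNIV i" and j: "closed_embedding UNIV j"
    and S: "closed S" "continuous_on S (\<lambda>x. h (i x))" and T: "closed T" "continuous_on T (\<lambda>y. h (j y))"
  shows "continuous_on (i ` S \<union> j ` T) h"
proof (rule continuous_on_closed_Un)
  show "continuous_on (i ` S) h" "continuous_on (j ` T) h"
    using closed_embedding_subset[OF i S(1) subset_UNIV] closed_embedding_subset[OF j T(1) subset_UNIV] S(2) T(2)
    by (simp_all add: continuous_on_closed_embedding_image)
  show "closed (i ` S)" "closed (j ` T)"
    using closed_embedding_image_closed[OF i S(1)] closed_embedding_image_closed[OF j T(1)] by auto
qed

text \<open>
  The pullback of a compactly supported function vanishes outside a compact set, because preimages
  of compact sets under a closed embedding are compact. The facts are stated as needed by
  \<open>set_integrable_compact_support\<close> and \<open>Tietze_compact_support\<close>.\<close>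

lemma Cc_closed_embedding:
  assumes f: "closed_embedding S f" and F: "F \<in> Cc"
  shows "continuous_on S (\<lambda>x. F (f x))" "compact {x\<in>S. f x \<in> closure {y. F y \<noteq> 0}}"
    "{x\<in>S. F (f x) \<noteq> 0} \<subseteq> {x\<in>S. f x \<in> closure {y. F y \<noteq> 0}}"
proof -
  have F: "continuous_on UNIV F" "compact (closure {y. F y \<noteq> 0})"
    using F by (auto simp: Cc_def)
  show "continuous_on S (\<lambda>x. F (f x))"
    by (rule continuous_on_compose2[OF F(1) closed_embeddingD(3)[OF f]]) simp
  show "compact {x\<in>S. f x \<in> closure {y. F y \<noteq> 0}}"
    by (rule compact_closed_embedding_vimage[OF f F(2)])
  show "{x\<in>S. F (f x) \<noteq> 0} \<subseteq> {x\<in>S. f x \<in> closure {y. F y \<noteq> 0}}"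
    using closure_subset[of "{y. F y \<noteq> 0}"] by blast
qed

lemma set_integrable_closed_embedding:
  fixes f :: "'a::t2_space \<Rightarrow> 'b::topological_space"
  assumes "radon_measure M" and f: "closed_embedding S f" and F: "F \<in> Cc"
  shows "set_integrable M S (\<lambda>x. F (f x))"
  using Cc_closed_embedding[OF f F] closed_embeddingD(1)[OF f] assms(1)
  by (intro set_integrable_compact_support)

lemma Cc_extension_closed_embedding:
  fixes f :: "'a::t2_space \<Rightarrow> 'b::topological_space"
  assumes lc: "locally_compact_space (euclidean :: 'a topology)"
    and f: "closed_embedding S f" and F: "F \<in> Cc"
  obtains k where "k \<in> Cc" "\<And>x. x \<in> S \<Longrightarrow> k x = F (f x)"
  using Tietze_compact_support[OF lc closed_embeddingD(1)[OF f] Cc_closed_embedding[OF f F]] by metis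

lemma Cc_comp_closed_embedding:
  fixes i :: "'a::t2_space \<Rightarrow> 'b::topological_space"
  assumes i: "closed_embedding UNIV i" and F: "F \<in> Cc"
  shows "(\<lambda>x. F (i x)) \<in> Cc"
  using Cc_closed_embedding[OF i F]
  by (intro Cc_I[where K = "{x\<in>UNIV. i x \<in> closure {y. F y \<noteq> 0}}"]) auto

section \<open>Images of measures under closed embeddings\<close>

definition push :: "'a::topological_space measure \<Rightarrow> 'a set \<Rightarrow> ('a \<Rightarrow> 'b::topological_space) \<Rightarrow> 'b measure" where
  "push M S f = distr (restrict_space M S) borel f"

lemma sets_push [simp, measurable_cong]: "sets (push M S f) = sets borel"
  by (simp add: push_def)

lemma space_push [simp]: "space (push M S f) = UNIV"
  by (simp add: push_def)

lemma measurable_push: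
  assumes "sets M = sets borel" "closed_embedding S f"
  shows "f \<in> measurable (restrict_space M S) borel"
  using borel_measurable_continuous_on_restrict[OF closed_embeddingD(3)[OF assms(2)]]
    measurable_cong_sets[OF sets_restrict_space_cong[OF assms(1)] refl] by blast

lemma emeasure_push:
  assumes M: "sets M = sets borel" and f: "closed_embedding S f" and B: "B \<in> sets borel"
  shows "emeasure (push M S f) B = emeasure M {x\<in>S. f x \<in> B}"
    "{x\<in>S. f x \<in> B} \<in> sets borel"
proof -
  have S: "S \<in> sets M" using closed_embeddingD(1)[OF f] M by simp
  have sp: "space M = UNIV" using sets_eq_imp_space_eq[OF M] by simp
  have eq: "f -` B \<inter> space (restrict_space M S) = {x\<in>S. f x \<in> B}"
    by (auto simp: space_restrict_space sp)
  have "f -` B \<inter> space (restrict_space M S) \<in> sets (restrict_space M S)"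
    using measurable_push[OF M f] B by (rule measurable_sets)
  then show "{x\<in>S. f x \<in> B} \<in> sets borel"
    unfolding eq using S M by (auto simp: sets_restrict_space)
  show "emeasure (push M S f) B = emeasure M {x\<in>S. f x \<in> B}"
    unfolding push_def emeasure_distr[OF measurable_push[OF M f] B] eq
    using S sp by (intro emeasure_restrict_space) auto
qed

lemma integral_push:
  fixes h :: "'b::topological_space \<Rightarrow> complex"
  assumes M: "sets M = sets borel" and f: "closed_embedding S f" and h: "h \<in> borel_measurable borel"
  shows "(\<integral>y. h y \<partial>push M S f) = (LINT x:S|M. h (f x))"
    and "integrable (push M S f) h \<longleftrightarrow> set_integrable M S (\<lambda>x. h (f x))"
proof -
  have S: "S \<inter> space M \<in> sets M" using closed_embeddingD(1)[OF f] M by simp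
  note m = measurable_push[OF M f]
  show "(\<integral>y. h y \<partial>push M S f) = (LINT x:S|M. h (f x))"
    unfolding push_def set_lebesgue_integral_def
    using integral_distr[OF m h] integral_restrict_space[OF S, of "\<lambda>x. h (f x)"] by simp
  show "integrable (push M S f) h \<longleftrightarrow> set_integrable M S (\<lambda>x. h (f x))"
    unfolding push_def set_integrable_def
    using integrable_distr_eq[OF m h] integrable_restrict_space[OF S, of "\<lambda>x. h (f x)"] by simp
qed

text \<open>
  A version for integrands such as \<open>z \<mapsto> F(xz)\<close>, which are meaningful, and continuous, on a fibre
  only.\<close>

lemma set_integral_push:
  fixes h :: "'b::topological_space \<Rightarrow> complex"
  assumes M: "sets M = sets borel" and f: "closed_embedding S f"
    and T: "closed T" "f ` S \<subseteq> T" "continuous_on T h"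
  shows "(LINT y:T|push M S f. h y) = (LINT x:S|M. h (f x))"
    and "set_integrable (push M S f) T h \<longleftrightarrow> set_integrable M S (\<lambda>x. h (f x))"
proof -
  have m: "(\<lambda>y. indicator T y *\<^sub>R h y) \<in> borel_measurable borel"
    using borel_measurable_continuous_on_indicator[OF _ T(3)] T(1) by simp
  have eq: "(\<lambda>x. indicator S x *\<^sub>R indicator T (f x) *\<^sub>R h (f x)) = (\<lambda>x. indicator S x *\<^sub>R h (f x))"
    using T(2) by (auto simp: indicator_def fun_eq_iff)
  show "(LINT y:T|push M S f. h y) = (LINT x:S|M. h (f x))"
    using integral_push(1)[OF M f m] eq by (simp add: set_lebesgue_integral_def)
  show "set_integrable (push M S f) T h \<longleftrightarrow> set_integrable M S (\<lambda>x. h (f x))"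
    using integral_push(2)[OF M f m] eq by (simp add: set_integrable_def)
qed

text \<open>
  For outer regularity, an open \<open>V\<close> around the preimage of \<open>B\<close> yields the open set
  \<open>- f ` (S - V)\<close> around \<open>B\<close>, of no larger mass. For inner regularity, the preimage of an open set is
  only relatively open in \<open>S\<close>; since \<open>- S\<close> is a null set, it has the mass of an honest open set, whose
  compact subsets can be cut down to \<open>S\<close> and mapped forward.\<close>

lemma radon_push:
  fixes M :: "'a::t2_space measure" and f :: "'a \<Rightarrow> 'b::t2_space"
  assumes M: "radon_measure M" and f: "closed_embedding S f" and null: "emeasure M (- S) = 0"
  shows "radon_measure (push M S f)"
  unfolding radon_measure_def
proof (intro conjI ballI allI impI)
  note D = closed_embeddingD[OF f]
  note sM = radon_sets[OF M]
  note em = emeasure_push[OF sM f]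
  show "sets (push M S f) = sets borel" by simp
  show "emeasure (push M S f) K < \<infinity>" if "compact K" for K
    using em[of K] that radon_compact_finite[OF M compact_closed_embedding_vimage[OF f that]]
    by (simp add: compact_imp_closed)
next
  note D = closed_embeddingD[OF f]
  note sM = radon_sets[OF M]
  note em = emeasure_push[OF sM f]
  fix B :: "'b set" assume B: "B \<in> sets borel"
  let ?B = "{x\<in>S. f x \<in> B}"
  show "emeasure (push M S f) B = (INF U\<in>{U. B \<subseteq> U \<and> open U}. emeasure (push M S f) U)"
  proof (rule antisym)
    show "emeasure (push M S f) B \<le> (INF U\<in>{U. B \<subseteq> U \<and> open U}. emeasure (push M S f) U)"
      by (intro INF_greatest emeasure_mono) auto
    have "(INF U\<in>{U. B \<subseteq> U \<and> open U}. emeasure (push M S f) U) \<le> emeasure M V"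
      if V: "?B \<subseteq> V" "open V" for V
    proof -
      define U where "U = - (f ` (S - V))"
      have U: "open U" "B \<subseteq> U" unfolding U_def
        using closed_embedding_image_closed[OF f, of "S - V"] V D(1) by (auto simp: closed_Diff)
      then have "(INF U\<in>{U. B \<subseteq> U \<and> open U}. emeasure (push M S f) U) \<le> emeasure (push M S f) U"
        by (intro INF_lower) auto
      also have "\<dots> = emeasure M {x\<in>S. f x \<in> U}" using em(1)[of U] U by simp
      also have "\<dots> \<le> emeasure M V"
        using V sM by (intro emeasure_mono) (auto simp: U_def)
      finally show ?thesis .
    qed
    then have "(INF U\<in>{U. B \<subseteq> U \<and> open U}. emeasure (push M S f) U) \<le> (INF V\<in>{V. ?B \<subseteq> V \<and> open V}. emeasure M V)"
      by (intro INF_greatest) auto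
    also have "\<dots> = emeasure (push M S f) B"
      using radon_borel_eq[OF M em(2)[OF B]] em(1)[OF B] by simp
    finally show "(INF U\<in>{U. B \<subseteq> U \<and> open U}. emeasure (push M S f) U) \<le> emeasure (push M S f) B" .
  qed
next
  note D = closed_embeddingD[OF f]
  note sM = radon_sets[OF M]
  note em = emeasure_push[OF sM f]
  fix U :: "'b set" assume U: "open U"
  show "emeasure (push M S f) U = (SUP K\<in>{K. K \<subseteq> U \<and> compact K}. emeasure (push M S f) K)"
  proof (rule antisym)
    show "(SUP K\<in>{K. K \<subseteq> U \<and> compact K}. emeasure (push M S f) K) \<le> emeasure (push M S f) U"
      using U by (intro SUP_least emeasure_mono) auto
    obtain V where "open V" "V \<inter> S = f -` U \<inter> S"
      using D(3) U unfolding continuous_on_open_invariant by blast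
    then have V: "open V" "{x\<in>S. f x \<in> U} = S \<inter> V" by auto
    have "emeasure (push M S f) U \<le> emeasure M V"
      using em(1)[of U] U V sM by (auto intro!: emeasure_mono)
    also have "\<dots> = (SUP K\<in>{K. K \<subseteq> V \<and> compact K}. emeasure M K)"
      by (rule radon_open_eq[OF M V(1)])
    also have "\<dots> \<le> (SUP K\<in>{K. K \<subseteq> U \<and> compact K}. emeasure (push M S f) K)"
    proof (intro SUP_least)
      fix K assume "K \<in> {K. K \<subseteq> V \<and> compact K}"
      then have K: "K \<subseteq> V" "compact K" by auto
      have KS: "compact (S \<inter> K)" using K D(1) by (simp add: closed_Int_compact)
      have fK: "compact (f ` (S \<inter> K))"
        using KS D(3) by (intro compact_continuous_image) (auto intro: continuous_on_subset)
      have "emeasure M K \<le> emeasure M (S \<inter> K) + emeasure M (- S)"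
        using sM D(1) KS by (intro order_trans[OF emeasure_mono emeasure_subadditive])
          (auto simp: compact_imp_closed)
      also have "\<dots> = emeasure M (S \<inter> K)" using null by simp
      also have "\<dots> \<le> emeasure M {x\<in>S. f x \<in> f ` (S \<inter> K)}"
        using em(2)[of "f ` (S \<inter> K)"] fK sM by (intro emeasure_mono) (auto simp: compact_imp_closed)
      also have "\<dots> = emeasure (push M S f) (f ` (S \<inter> K))"
        using em(1)[of "f ` (S \<inter> K)"] fK by (simp add: compact_imp_closed)
      also have "\<dots> \<le> (SUP K\<in>{K. K \<subseteq> U \<and> compact K}. emeasure (push M S f) K)"
        using fK K V by (intro SUP_upper) blast
      finally show "emeasure M K \<le> (SUP K\<in>{K. K \<subseteq> U \<and> compact K}. emeasure (push M S f) K)" .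
    qed
    finally show "emeasure (push M S f) U \<le> (SUP K\<in>{K. K \<subseteq> U \<and> compact K}. emeasure (push M S f) K)" .
  qed
qed

lemma msupp_push:
  fixes M :: "'a::t2_space measure" and f :: "'a \<Rightarrow> 'b::t2_space"
  assumes M: "sets M = sets borel" and f: "closed_embedding S f" and null: "emeasure M (- S) = 0"
    and supp: "msupp M \<subseteq> S"
  shows "msupp (push M S f) = f ` msupp M"
proof
  note D = closed_embeddingD[OF f]
  note em = emeasure_push[OF M f]
  show "msupp (push M S f) \<subseteq> f ` msupp M"
  proof
    fix y assume y: "y \<in> msupp (push M S f)"
    have "{x\<in>S. f x \<in> - f ` S} = {}" by auto
    then have "emeasure (push M S f) (- f ` S) = 0"
      using em(1)[of "- f ` S"] D(2) by (simp only: borel_open open_Compl emeasure_empty)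
    then have "y \<notin> - f ` S"
      using y D(2) unfolding msupp_def by (metis (mono_tags, lifting) mem_Collect_eq not_gr_zero open_Compl)
    then obtain x where x: "x \<in> S" "y = f x" by auto
    have "x \<in> msupp M" unfolding msupp_def
    proof (intro CollectI allI impI)
      fix V assume V: "open V \<and> x \<in> V"
      define U where "U = - (f ` (S - V))"
      have "open U" "y \<in> U" unfolding U_def
        using closed_embedding_image_closed[OF f, of "S - V"] V D(1,5) x
        by (auto simp: closed_Diff inj_on_def)
      then have "0 < emeasure (push M S f) U" using y by (auto simp: msupp_def)
      also have "\<dots> = emeasure M {x\<in>S. f x \<in> U}" using em(1)[of U] \<open>open U\<close> by simp
      also have "\<dots> \<le> emeasure M V"
        using V M by (intro emeasure_mono) (auto simp: U_def)
      finally show "0 < emeasure M V" .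
    qed
    then show "y \<in> f ` msupp M" using x by blast
  qed
  show "f ` msupp M \<subseteq> msupp (push M S f)"
  proof
    fix y assume "y \<in> f ` msupp M"
    then obtain x where x: "x \<in> msupp M" "x \<in> S" "y = f x" using supp by auto
    show "y \<in> msupp (push M S f)" unfolding msupp_def
    proof (intro CollectI allI impI)
      fix U assume U: "open U \<and> y \<in> U"
      obtain V where "open V" "V \<inter> S = f -` U \<inter> S"
        using D(3) conjunct1[OF U] unfolding continuous_on_open_invariant by blast
      then have V: "open V" "{x\<in>S. f x \<in> U} = S \<inter> V" by auto
      have "0 < emeasure M V" using V x U by (auto simp: msupp_def)
      also have "\<dots> \<le> emeasure M (S \<inter> V) + emeasure M (- S)"
        using M D(1) V by (intro order_trans[OF emeasure_mono emeasure_subadditive]) auto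
      also have "\<dots> = emeasure (push M S f) U" using null em(1)[of U] U V(2) by simp
      finally show "0 < emeasure (push M S f) U" .
    qed
  qed
qed

section \<open>Gluing two measures on a disjoint union\<close>

text \<open>
  The fibre of the linking groupoid over a unit is the disjoint union of two pieces, a piece of \<open>G\<close>
  and one of \<open>Z\<close>, or a piece of the opposite space and one of \<open>H\<close>. Both kinds are instances of the
  following situation.\<close>

locale disjoint_embeddings =
  fixes i :: "'a::t2_space \<Rightarrow> 'c::t2_space" and j :: "'b::t2_space \<Rightarrow> 'c"
    and M :: "'a measure" and N :: "'b measure"
  assumes i: "closed_embedding UNIV i" and j: "closed_embedding UNIV j"
    and disjoint: "i x \<noteq> j y"
    and M: "radon_measure M" and N: "radon_measure N"
begin

definition "glue = add_measure (push M UNIV i) (push N UNIV j)"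

lemma sets_M: "sets M = sets borel" and sets_N: "sets N = sets borel"
  using M N by (auto simp: radon_sets)

lemma radon_glue: "radon_measure glue"
  unfolding glue_def using M N i j by (intro radon_add_measure radon_push) auto

lemma msupp_glue: "msupp glue = i ` msupp M \<union> j ` msupp N"
  unfolding glue_def using sets_M sets_N i j by (simp add: msupp_add_measure msupp_push)

lemma set_integral_glue:
  fixes h :: "'c \<Rightarrow> complex"
  assumes S: "closed S" "continuous_on S (\<lambda>x. h (i x))" "set_integrable M S (\<lambda>x. h (i x))"
    and T: "closed T" "continuous_on T (\<lambda>y. h (j y))" "set_integrable N T (\<lambda>y. h (j y))"
  shows "(LINT z:i ` S \<union> j ` T|glue. h z) = (LINT x:S|M. h (i x)) + (LINT y:T|N. h (j y))"
proof -
  let ?h = "\<lambda>z. indicator (i ` S \<union> j ` T) z *\<^sub>R h z"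
  have cl: "closed (i ` S \<union> j ` T)"
    using S T i j by (auto intro!: closed_Un closed_embedding_image_closed)
  have m: "?h \<in> borel_measurable borel"
    using cl continuous_on_image_Un[OF i j S(1,2) T(1,2)]
    by (intro borel_measurable_continuous_on_indicator) auto
  have hi: "?h (i x) = indicator S x *\<^sub>R h (i x)" for x
    using closed_embeddingD(5)[OF i] disjoint by (auto simp: indicator_def inj_def image_iff)
  have hj: "?h (j y) = indicator T y *\<^sub>R h (j y)" for y
    using closed_embeddingD(5)[OF j] disjoint[symmetric] by (auto simp: indicator_def inj_def image_iff)
  have intM: "integrable (push M UNIV i) ?h" and intN: "integrable (push N UNIV j) ?h"
    using integral_push(2)[OF sets_M i m] integral_push(2)[OF sets_N j m] S(3) T(3)
    unfolding hi hj by (simp_all add: set_integrable_def)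
  have "(\<integral>z. ?h z \<partial>glue) = (\<integral>z. ?h z \<partial>push M UNIV i) + (\<integral>z. ?h z \<partial>push N UNIV j)"
    unfolding glue_def by (rule integral_add_measure(2)[OF _ intM intN]) simp
  also have "(\<integral>z. ?h z \<partial>push M UNIV i) = (LINT x:S|M. h (i x))"
    using integral_push(1)[OF sets_M i m] unfolding hi by (simp add: set_lebesgue_integral_def)
  also have "(\<integral>z. ?h z \<partial>push N UNIV j) = (LINT y:T|N. h (j y))"
    using integral_push(1)[OF sets_N j m] unfolding hj by (simp add: set_lebesgue_integral_def)
  finally show ?thesis by (simp add: set_lebesgue_integral_def)
qed

lemma integral_glue:
  fixes F :: "'c \<Rightarrow> complex"
  assumes F: "F \<in> Cc"
  shows "(\<integral>z. F z \<partial>glue) = (\<integral>x. F (i x) \<partial>M) + (\<integral>y. F (j y) \<partial>N)"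
proof -
  have m: "F \<in> borel_measurable borel" using F by (auto simp: Cc_def intro: borel_measurable_continuous_onI)
  have "integrable (push M UNIV i) F" "integrable (push N UNIV j) F"
    using F M N i j by (auto intro!: Cc_integrable radon_push)
  then show ?thesis
    using integral_add_measure(2)[of "push M UNIV i" "push N UNIV j" F]
      integral_push(1)[OF sets_M i m] integral_push(1)[OF sets_N j m]
    by (simp add: glue_def set_lebesgue_integral_def)
qed

end

section \<open>Groupoids and their Haar systems\<close>

lemma haar_systemD:
  assumes "haar_system G \<alpha>" "u \<in> units G"
  shows "radon_measure (\<alpha> u)" "msupp (\<alpha> u) = rfib G u"
  using assms by (auto simp: haar_system_def)

lemma haar_system_invariant:
  "haar_system G \<alpha> \<Longrightarrow> f \<in> Cc \<Longrightarrow>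
    (LINT y:rfib G (src G x)|\<alpha> (src G x). f (mul G x y)) = (\<integral>y. f y \<partial>\<alpha> (rng G x))"
  by (simp add: haar_system_def)

context lch_groupoid begin

lemma closed_rfib: "closed (rfib G u)"
  unfolding rfib_def using continuous_rng by (intro closed_Collect_eq) (auto intro: continuous_intros)

lemma src_in_units: "src G x \<in> units G"
  unfolding units_def using rng_src[of x] by (metis rangeI)

lemma rng_in_units: "rng G x \<in> units G"
  by (auto simp: units_def)

lemma mul_cancel_left:
  assumes "src G x = rng G y"
  shows "mul G (ginv G x) (mul G x y) = y"
  using mul_assoc[of "ginv G x" x y] assms mul_unit_left[of y] by (simp add: src_inv mul_inv_left)

lemma ginv_ginv: "ginv G (ginv G x) = x"
  using mul_cancel_left[of "ginv G x" x] mul_unit_right[of "ginv G (ginv G x)"]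
  by (simp add: src_inv rng_inv mul_inv_left)

lemma unit_simps:
  assumes "u \<in> units G"
  shows "rng G u = u" "src G u = u" "ginv G u = u"
proof -
  show r: "rng G u = u" and s: "src G u = u"
    using assms rng_rng src_rng by (auto simp: units_def)
  have "ginv G u = mul G (ginv G u) u"
    using mul_unit_right[of "ginv G u"] r by (simp add: src_inv)
  then show "ginv G u = u" using mul_inv_left[of u] s by simp
qed

lemma ginv_mul:
  assumes "src G x = rng G y"
  shows "ginv G (mul G x y) = mul G (ginv G y) (ginv G x)"
proof -
  let ?a = "mul G x y" and ?b = "mul G (ginv G y) (ginv G x)"
  have b: "src G (ginv G y) = rng G (ginv G x)" using assms by (simp add: src_inv rng_inv)
  have "mul G ?a ?b = mul G x (mul G y ?b)"
    using assms b by (intro mul_assoc) (simp_all add: rng_mul rng_inv)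
  also have "mul G y ?b = ginv G x"
    using mul_assoc[of y "ginv G y" "ginv G x"] assms b mul_unit_left[of "ginv G x"]
    by (simp add: rng_inv mul_inv_right src_inv)
  finally have ab: "mul G ?a ?b = rng G ?a" using assms by (simp add: mul_inv_right rng_mul)
  have "?b = mul G (ginv G ?a) (mul G ?a ?b)"
    using assms b by (intro mul_cancel_left[symmetric]) (simp add: src_mul rng_mul rng_inv)
  also have "\<dots> = ginv G ?a" using ab mul_unit_right[of "ginv G ?a"] by (simp add: src_inv)
  finally show ?thesis by simp
qed

lemma translation_embedding: "closed_embedding (rfib G (src G x)) (mul G x)"
proof (rule closed_embeddingI_inverse[where g = "mul G (ginv G x)"])
  have cont: "continuous_on (rfib G (src G x)) (mul G x)" for x
  proof -
    have "continuous_on (rfib G (src G x)) (\<lambda>y. case (x, y) of (x, y) \<Rightarrow> mul G x y)"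
      by (rule continuous_on_compose2[OF continuous_mul])
        (auto simp: rfib_def intro!: continuous_on_Pair continuous_on_const continuous_on_id)
    then show ?thesis by simp
  qed
  have sub: "mul G x ` rfib G (src G x) \<subseteq> rfib G (rng G x)" for x
    by (auto simp: rfib_def rng_mul)
  have inv: "mul G (ginv G x) (mul G x y) = y" if "y \<in> rfib G (src G x)" for x y
    using that by (auto simp: rfib_def mul_cancel_left)
  have im: "mul G x ` rfib G (src G x) = rfib G (rng G x)"
  proof
    show "rfib G (rng G x) \<subseteq> mul G x ` rfib G (src G x)"
    proof
      fix y assume "y \<in> rfib G (rng G x)"
      then show "y \<in> mul G x ` rfib G (src G x)"
        using inv[of y "ginv G x"] sub[of "ginv G x"]
        by (intro image_eqI[of _ _ "mul G (ginv G x) y"]) (auto simp: ginv_ginv src_inv rng_inv)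
    qed
  qed (rule sub)
  show "closed (rfib G (src G x))" by (rule closed_rfib)
  show "closed (mul G x ` rfib G (src G x))" unfolding im by (rule closed_rfib)
  show "continuous_on (rfib G (src G x)) (mul G x)" by (rule cont)
  show "continuous_on (mul G x ` rfib G (src G x)) (mul G (ginv G x))"
    using cont[of "ginv G x"] unfolding im by (simp add: src_inv)
  show "mul G (ginv G x) (mul G x y) = y" if "y \<in> rfib G (src G x)" for y
    using that by (rule inv)
qed

lemma closed_units: "closed (units G)"
proof -
  have "units G = {x. rng G x = x}"
  proof (intro set_eqI iffI)
    fix x assume "x \<in> {x. rng G x = x}"
    then show "x \<in> units G" using rng_in_units[of x] by simp
  qed (simp add: unit_simps)
  then show ?thesis using continuous_rng by (auto intro!: closed_Collect_eq continuous_intros)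
qed

lemma haar_null:
  assumes "haar_system G \<alpha>" "u \<in> units G"
  shows "emeasure (\<alpha> u) (- rfib G u) = 0"
  using emeasure_compl_support[OF radon_sets, of "\<alpha> u" "rfib G u"] haar_systemD[OF assms] closed_rfib by simp

lemma haar_integral_rfib:
  assumes "haar_system G \<alpha>" "u \<in> units G" "f \<in> Cc"
  shows "(LINT x:rfib G u|\<alpha> u. f x) = (\<integral>x. f x \<partial>\<alpha> u)"
  using assms haar_systemD[OF assms(1,2)]
  by (intro set_lebesgue_integral_full closed_rfib haar_null Cc_measurable radon_sets)

end

section \<open>Principal spaces\<close>

text \<open>
  The part of the definition of an equivalence which concerns the \<open>H\<close>-action, in a form that is
  the same for \<open>Z\<close> and for the opposite space. The conditions on the structure map \<open>rmap Z\<close> say that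
  it identifies the orbit space with \<open>A\<close>.\<close>

locale principal_space = H: lch_groupoid H
  for H :: "'h::{second_countable_topology, t2_space} groupoid" +
  fixes Z :: "('g::t2_space, 'z::t2_space, 'h) bispace" and A :: "'g set"
  assumes locally_compact_Z: "locally_compact_space (euclidean :: 'z topology)"
    and right_space: "right_space H (smap Z) (ract Z)"
    and right_free: "right_free H (smap Z) (ract Z)"
    and right_proper: "right_proper H (smap Z) (ract Z)"
    and continuous_rmap: "continuous_on UNIV (rmap Z)"
    and open_rmap: "open_map euclidean (top_of_set A) (rmap Z)"
    and range_rmap: "range (rmap Z) = A"
    and rmap_eq_iff: "rmap Z y = rmap Z z \<longleftrightarrow> (\<exists>x. smap Z y = rng H x \<and> z = ract Z y x)"
begin

lemma continuous_smap: "continuous_on UNIV (smap Z)"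
  and smap_in_units: "smap Z z \<in> units H"
  and continuous_ract: "continuous_on {(z, x). smap Z z = rng H x} (\<lambda>(z, x). ract Z z x)"
  and smap_ract: "smap Z z = rng H x \<Longrightarrow> smap Z (ract Z z x) = src H x"
  and ract_unit: "ract Z z (smap Z z) = z"
  and ract_mul: "smap Z z = rng H x \<Longrightarrow> src H x = rng H y \<Longrightarrow> ract Z z (mul H x y) = ract Z (ract Z z x) y"
  using right_space by (auto simp: right_space_def continuous_map_in_subtopology)

text \<open>
  If \<open>zx = zy\<close>, then \<open>y\<^sup>-\<^sup>1x\<close> fixes \<open>zy\<close> and is a unit by freeness.\<close>

lemma ract_inj:
  assumes "smap Z z = rng H x" "smap Z z = rng H y" "ract Z z x = ract Z z y"
  shows "x = y"
proof -
  have c: "src H (ginv H y) = rng H x" using assms by (simp add: H.src_inv)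
  have "ract Z (ract Z z y) (mul H (ginv H y) x) = ract Z z (mul H y (mul H (ginv H y) x))"
    using assms c by (intro ract_mul[symmetric]) (simp_all add: H.rng_mul H.rng_inv)
  also have "mul H y (mul H (ginv H y) x) = x"
    using H.mul_assoc[of y "ginv H y" x] assms c H.mul_unit_left[of x]
    by (simp add: H.rng_inv H.mul_inv_right)
  finally have "ract Z (ract Z z y) (mul H (ginv H y) x) = ract Z z y" using assms by simp
  moreover have "smap Z (ract Z z y) = rng H (mul H (ginv H y) x)"
    using assms c by (simp add: smap_ract H.rng_mul H.rng_inv)
  ultimately have "mul H (ginv H y) x = smap Z (ract Z z y)"
    using right_free by (auto simp: right_free_def)
  then have "mul H (ginv H y) x = src H y" using assms by (simp add: smap_ract)
  then have "mul H y (mul H (ginv H y) x) = y" by (simp add: H.mul_unit_right)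
  with \<open>mul H y (mul H (ginv H y) x) = x\<close> show ?thesis by simp
qed

lemma closed_fibre: "closed {y. rmap Z y = u}"
  using continuous_rmap by (intro closed_Collect_eq) (auto intro: continuous_intros)

lemma orbit_image: "ract Z z ` rfib H (smap Z z) = {y. rmap Z y = rmap Z z}"
  using rmap_eq_iff[of z] by (auto simp: rfib_def image_iff) metis+

lemma closed_composable: "closed {(z, x). smap Z z = rng H x}"
proof -
  have "{(z, x). smap Z z = rng H x} = {p. smap Z (fst p) = rng H (snd p)}" by auto
  then show ?thesis
    using continuous_smap H.continuous_rng
    by (auto intro!: closed_Collect_eq continuous_on_compose2[of UNIV "smap Z"]
        continuous_on_compose2[of UNIV "rng H"] continuous_intros)
qed

text \<open>
  Injectivity comes from freeness and closedness from properness: the orbit map is the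
  restriction of the closed map \<open>(z, x) \<mapsto> (zx, z)\<close> to one value of \<open>z\<close>.\<close>

lemma orbit_embedding: "closed_embedding (rfib H (smap Z z)) (ract Z z)"
proof (rule closed_embeddingI)
  show "closed (rfib H (smap Z z))" by (rule H.closed_rfib)
  show "continuous_on (rfib H (smap Z z)) (ract Z z)"
  proof -
    have "continuous_on (rfib H (smap Z z)) (\<lambda>x. case (z, x) of (z, x) \<Rightarrow> ract Z z x)"
      by (rule continuous_on_compose2[OF continuous_ract])
        (auto simp: rfib_def intro!: continuous_on_Pair continuous_on_const continuous_on_id)
    then show ?thesis by simp
  qed
  show "inj_on (ract Z z) (rfib H (smap Z z))"
    using ract_inj by (auto intro!: inj_onI simp: rfib_def)
  fix C assume C: "closed C" "C \<subseteq> rfib H (smap Z z)"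
  have "closedin (top_of_set {(z, x). smap Z z = rng H x}) ({z} \<times> C)"
    using C closed_composable by (intro closed_subset closed_Times) (auto simp: rfib_def)
  moreover have "closed_map (top_of_set {(z, x). smap Z z = rng H x}) euclidean (\<lambda>(z, x). (ract Z z x, z))"
    using right_proper by (simp add: right_proper_def proper_map_def)
  ultimately have "closed ((\<lambda>(z, x). (ract Z z x, z)) ` ({z} \<times> C))"
    by (simp add: closed_map_def)
  then have "closed ((\<lambda>y. (y, z)) -` ((\<lambda>(z, x). (ract Z z x, z)) ` ({z} \<times> C)))"
    by (rule closed_vimage) (auto intro: continuous_intros)
  moreover have "(\<lambda>y. (y, z)) -` ((\<lambda>(z, x). (ract Z z x, z)) ` ({z} \<times> C)) = ract Z z ` C"
    by force
  ultimately show "closed (ract Z z ` C)" by simp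
qed

lemma rbracket_ract:
  assumes "smap Z z = rng H x"
  shows "rbracket H Z z (ract Z z x) = x"
  unfolding rbracket_def using assms ract_inj by (intro the_equality) auto

end

section \<open>The measures on a principal space\<close>

locale principal_haar_space = principal_space H Z A
  for H :: "'h::{second_countable_topology, t2_space} groupoid"
    and Z :: "('g::t2_space, 'z::t2_space, 'h) bispace" and A :: "'g set" +
  fixes \<beta> :: "'h \<Rightarrow> 'h measure"
  assumes haar: "haar_system H \<beta>"
begin

lemma radon_beta: "radon_measure (\<beta> (smap Z z))"
  and sets_beta: "sets (\<beta> (smap Z z)) = sets borel"
  by (rule haar_systemD[OF haar smap_in_units], rule radon_sets, rule haar_systemD[OF haar smap_in_units])

text \<open>
  This is why \<open>\<sigma>\<^sup>u\<close> is well defined. The points \<open>y\<close> and \<open>z = yx\<^sub>0\<close> are related by \<open>x\<^sub>0\<close>, and the claim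
  is left invariance of \<open>\<beta>\<close> under \<open>x\<^sub>0\<close>, applied to an extension of \<open>x \<mapsto> f(yx)\<close> to all of \<open>H\<close>.\<close>

lemma orbit_integral_cong:
  assumes f: "f \<in> Cc" and eq: "rmap Z y = rmap Z z"
  shows "(LINT x:rfib H (smap Z y)|\<beta> (smap Z y). f (ract Z y x)) =
         (LINT x:rfib H (smap Z z)|\<beta> (smap Z z). f (ract Z z x))"
proof -
  obtain x0 where x0: "smap Z y = rng H x0" "z = ract Z y x0" using eq rmap_eq_iff by auto
  have sz: "smap Z z = src H x0" using x0 by (simp add: smap_ract)
  obtain k where k: "k \<in> Cc" "\<And>x. x \<in> rfib H (smap Z y) \<Longrightarrow> k x = f (ract Z y x)"
    using Cc_extension_closed_embedding[OF H.locally_compact orbit_embedding f] by metis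
  have "(LINT x:rfib H (smap Z y)|\<beta> (smap Z y). f (ract Z y x)) = (LINT x:rfib H (smap Z y)|\<beta> (smap Z y). k x)"
    using k H.closed_rfib sets_beta[of y] by (intro set_lebesgue_integral_cong) auto
  also have "\<dots> = (\<integral>x. k x \<partial>\<beta> (rng H x0))"
    using H.haar_integral_rfib[OF haar smap_in_units[of y] k(1)] x0 by simp
  also have "\<dots> = (LINT x:rfib H (smap Z z)|\<beta> (smap Z z). k (mul H x0 x))"
    using haar k(1) sz by (simp add: haar_system_def)
  also have "\<dots> = (LINT x:rfib H (smap Z z)|\<beta> (smap Z z). f (ract Z z x))"
    using H.closed_rfib sets_beta[of z] x0 sz
    by (intro set_lebesgue_integral_cong) (auto simp: rfib_def k(2) H.rng_mul ract_mul)
  finally show ?thesis .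
qed

abbreviation "\<sigma> \<equiv> sigma_measure H Z \<beta>"

lemma radon_push_orbit: "radon_measure (push (\<beta> (smap Z z)) (rfib H (smap Z z)) (ract Z z))"
  by (rule radon_push[OF radon_beta orbit_embedding H.haar_null[OF haar smap_in_units]])

lemma sigma_eq_push: "\<sigma> (rmap Z z) = push (\<beta> (smap Z z)) (rfib H (smap Z z)) (ract Z z)"
  unfolding sigma_measure_def
proof (rule the_equality)
  let ?P = "push (\<beta> (smap Z z)) (rfib H (smap Z z)) (ract Z z)"
  have int: "(\<integral>y. f y \<partial>?P) = (LINT x:rfib H (smap Z z)|\<beta> (smap Z z). f (ract Z z x))" if "f \<in> Cc" for f :: "'z \<Rightarrow> complex"
    by (rule integral_push(1)[OF sets_beta orbit_embedding Cc_measurable[OF that]])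
  show "radon_measure ?P \<and> (\<forall>y. rmap Z y = rmap Z z \<longrightarrow> (\<forall>f\<in>Cc.
        (\<integral>x. f x \<partial>?P) = (LINT x:rfib H (smap Z y)|\<beta> (smap Z y). f (ract Z y x))))"
    using radon_push_orbit int orbit_integral_cong by metis
  fix M assume M: "radon_measure M \<and> (\<forall>y. rmap Z y = rmap Z z \<longrightarrow> (\<forall>f\<in>Cc.
        (\<integral>x. f x \<partial>M) = (LINT x:rfib H (smap Z y)|\<beta> (smap Z y). f (ract Z y x))))"
  show "M = ?P"
    by (rule radon_measure_eqI[OF locally_compact_Z _ radon_push_orbit]) (use M int in auto)
qed

lemma sigma_radon: "u \<in> A \<Longrightarrow> radon_measure (\<sigma> u)"
  using range_rmap radon_push_orbit sigma_eq_push by (metis imageE)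

lemma msupp_sigma:
  assumes "u \<in> A"
  shows "msupp (\<sigma> u) = {y. rmap Z y = u}"
proof -
  obtain z where u: "u = rmap Z z" using assms range_rmap by auto
  show ?thesis unfolding u sigma_eq_push orbit_image[symmetric]
    using msupp_push[OF sets_beta orbit_embedding H.haar_null[OF haar smap_in_units]]
    by (simp add: haar_systemD(2)[OF haar smap_in_units])
qed

lemma integral_sigma:
  "f \<in> Cc \<Longrightarrow> (\<integral>y. f y \<partial>\<sigma> (rmap Z z)) = (LINT x:rfib H (smap Z z)|\<beta> (smap Z z). f (ract Z z x))"
  unfolding sigma_eq_push by (rule integral_push(1)[OF sets_beta orbit_embedding Cc_measurable])

lemma set_integral_sigma:
  fixes h :: "'z \<Rightarrow> complex"
  assumes h: "continuous_on {y. rmap Z y = rmap Z z} h"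
  shows "(LINT y:{y. rmap Z y = rmap Z z}|\<sigma> (rmap Z z). h y) =
      (LINT x:rfib H (smap Z z)|\<beta> (smap Z z). h (ract Z z x))"
  unfolding sigma_eq_push
  by (rule set_integral_push(1)[OF sets_beta orbit_embedding closed_fibre _ h]) (simp add: orbit_image)

text \<open>
  A map between fibres that commutes with the action of \<open>H\<close> carries an orbit map to an orbit map,
  hence \<open>\<sigma>\<close> to \<open>\<sigma>\<close>. This is applied to the translations by the other groupoid.\<close>

lemma sigma_equivariant:
  fixes f :: "'z \<Rightarrow> complex"
  assumes T: "continuous_on {y. rmap Z y = rmap Z z} T"
    and rT: "\<And>y. rmap Z y = rmap Z z \<Longrightarrow> rmap Z (T y) = w"
    and sT: "smap Z (T z) = smap Z z"
    and equiv: "\<And>x. smap Z z = rng H x \<Longrightarrow> T (ract Z z x) = ract Z (T z) x"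
    and f: "f \<in> Cc"
  shows "(LINT y:{y. rmap Z y = rmap Z z}|\<sigma> (rmap Z z). f (T y)) = (\<integral>y. f y \<partial>\<sigma> w)"
proof -
  have "continuous_on {y. rmap Z y = rmap Z z} (\<lambda>y. f (T y))"
    using f by (intro continuous_on_compose2[OF _ T, of UNIV f]) (auto simp: Cc_def)
  then have "(LINT y:{y. rmap Z y = rmap Z z}|\<sigma> (rmap Z z). f (T y)) =
      (LINT x:rfib H (smap Z z)|\<beta> (smap Z z). f (T (ract Z z x)))"
    by (rule set_integral_sigma)
  also have "\<dots> = (LINT x:rfib H (smap Z z)|\<beta> (smap Z z). f (ract Z (T z) x))"
    using H.closed_rfib sets_beta[of z]
    by (intro set_lebesgue_integral_cong) (auto simp: rfib_def equiv)
  also have "\<dots> = (\<integral>y. f y \<partial>\<sigma> (rmap Z (T z)))"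
    using integral_sigma[OF f, of "T z"] sT by simp
  finally show ?thesis using rT[of z] by simp
qed

lemma rbracket_embedding: "closed_embedding {y. rmap Z y = rmap Z z} (rbracket H Z z)"
  using closed_embedding_inverse[OF orbit_embedding, of z "rbracket H Z z"] rbracket_ract
  unfolding orbit_image by (simp add: rfib_def)

text \<open>
  For fixed \<open>z\<close> the bracket is inverse to the orbit map of \<open>z\<close>, so it carries \<open>\<sigma>\<close> back to \<open>\<beta>\<close>.\<close>

lemma sigma_rbracket:
  assumes f: "f \<in> Cc"
  shows "(LINT y:{y. rmap Z y = rmap Z z}|\<sigma> (rmap Z z). f (rbracket H Z z y)) = (\<integral>x. f x \<partial>\<beta> (smap Z z))"
proof -
  have "(LINT y:{y. rmap Z y = rmap Z z}|\<sigma> (rmap Z z). f (rbracket H Z z y)) =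
      (LINT x:rfib H (smap Z z)|\<beta> (smap Z z). f (rbracket H Z z (ract Z z x)))"
    by (rule set_integral_sigma[OF Cc_closed_embedding(1)[OF rbracket_embedding f]])
  also have "\<dots> = (LINT x:rfib H (smap Z z)|\<beta> (smap Z z). f x)"
    using H.closed_rfib sets_beta[of z]
    by (intro set_lebesgue_integral_cong) (auto simp: rfib_def rbracket_ract)
  also have "\<dots> = (\<integral>x. f x \<partial>\<beta> (smap Z z))"
    by (rule H.haar_integral_rfib[OF haar smap_in_units f])
  finally show ?thesis .
qed

text \<open>
  Fix \<open>z\<^sub>0\<close> and a compact neighbourhood \<open>N\<close> of it. By properness there is one compact set \<open>K1\<close> outside
  which \<open>x \<mapsto> f(zx)\<close> vanishes for all \<open>z \<in> N\<close>. Let \<open>k \<in> C\<^sub>c(H)\<close> extend \<open>x \<mapsto> f(z\<^sub>0x)\<close>, and enlarge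
  \<open>K1\<close> by the support of \<open>k\<close> to \<open>K2\<close>. For \<open>\<delta> > 0\<close> the pairs \<open>(z, x)\<close> in \<open>N \<times> K2\<close> for which \<open>zx\<close> is
  defined and \<open>\<bar>f(zx) - k(x)\<bar> \<ge> \<delta>\<close> form a compact set \<open>W\<close>, whose projection to \<open>Z\<close> is closed and misses
  \<open>z\<^sub>0\<close>. So for \<open>z\<close> near \<open>z\<^sub>0\<close> the integral of \<open>f(zx)\<close> differs from that of \<open>k\<close> by at most \<open>\<delta>\<close> times the
  integral \<open>b z\<close> of a cutoff function. Both \<open>b\<close> and the integral \<open>c\<close> of \<open>k\<close> depend continuously on \<open>z\<close>
  by the continuity of the Haar system.\<close>

lemma continuous_orbit_integral:
  fixes f :: "'z \<Rightarrow> complex"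
  assumes f: "f \<in> Cc"
  shows "continuous_on UNIV (\<lambda>z. LINT x:rfib H (smap Z z)|\<beta> (smap Z z). f (ract Z z x))"
proof -
  let ?D = "{(z, x). smap Z z = rng H x}"
  define \<Phi> where "\<Phi> z = (LINT x:rfib H (smap Z z)|\<beta> (smap Z z). f (ract Z z x))" for z
  have ev: "eventually (\<lambda>z. dist (\<Phi> z) (\<Phi> z0) < e) (nhds z0)" if e: "0 < e" for z0 e
  proof -
    obtain N0 N where N: "open N0" "compact N" "z0 \<in> N0" "N0 \<subseteq> N"
      using compact_relatively_compact_neighbourhood[OF locally_compact_Z, of "{z0}"] by auto
    define C where "C = closure {y. f y \<noteq> 0}"
    have C: "compact C" "\<And>y. f y \<noteq> 0 \<Longrightarrow> y \<in> C"
      using f closure_subset[of "{y. f y \<noteq> 0}"] by (auto simp: Cc_def C_def)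
    define K1 where "K1 = snd ` {p\<in>?D. (\<lambda>(z, x). (ract Z z x, z)) p \<in> C \<times> N}"
    have "compactin (top_of_set ?D) {p\<in>topspace (top_of_set ?D). (\<lambda>(z, x). (ract Z z x, z)) p \<in> C \<times> N}"
      using right_proper C N unfolding right_proper_def
      by (intro compactin_proper_map_preimage[where Y = euclidean]) (auto intro: compact_Times)
    then have "compact {p\<in>?D. (\<lambda>(z, x). (ract Z z x, z)) p \<in> C \<times> N}"
      by (simp add: compactin_subtopology)
    then have K1: "compact K1"
      unfolding K1_def by (intro compact_continuous_image continuous_intros)
    have K1f: "x \<in> K1" if "z \<in> N" "smap Z z = rng H x" "f (ract Z z x) \<noteq> 0" for z x
      using that C(2) unfolding K1_def by force
    obtain k where k: "k \<in> Cc" "\<And>x. x \<in> rfib H (smap Z z0) \<Longrightarrow> k x = f (ract Z z0 x)"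
      using Cc_extension_closed_embedding[OF H.locally_compact orbit_embedding f] by metis
    define K2 where "K2 = K1 \<union> closure {x. k x \<noteq> 0}"
    have K2: "compact K2" using K1 k by (auto simp: K2_def Cc_def)
    have kK2: "x \<in> K2" if "k x \<noteq> 0" for x
      using that closure_subset[of "{x. k x \<noteq> 0}"] by (auto simp: K2_def)
    obtain \<rho> :: "'h \<Rightarrow> real" where \<rho>: "continuous_on UNIV \<rho>" "\<And>x. 0 \<le> \<rho> x"
        "\<And>x. x \<in> K2 \<Longrightarrow> \<rho> x = 1" "compact (closure {x. \<rho> x \<noteq> 0})"
      using Urysohn_compact_support[OF H.locally_compact K2 open_UNIV] by (metis subset_UNIV)
    note \<rho>c = Cc_complex_of_real[OF \<rho>(1,4)]
    have int\<rho>: "integrable (\<beta> (smap Z z)) \<rho>" for z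
      using Cc_integrable[OF radon_beta \<rho>c, of z] by (simp add: complex_of_real_integrable_eq)
    have haarc: "continuous_on UNIV (\<lambda>z. \<integral>x. g x \<partial>\<beta> (smap Z z))" if "g \<in> Cc" for g
    proof (rule continuous_on_compose2[OF _ continuous_smap])
      show "continuous_on (units H) (\<lambda>v. \<integral>x. g x \<partial>\<beta> v)"
        using haar that unfolding haar_system_def by blast
      show "smap Z ` UNIV \<subseteq> units H" using smap_in_units by blast
    qed
    define b where "b z = (\<integral>x. \<rho> x \<partial>\<beta> (smap Z z))" for z
    define c where "c z = (\<integral>x. k x \<partial>\<beta> (smap Z z))" for z
    have bc: "continuous_on UNIV b"
      using continuous_on_Re[OF haarc[OF \<rho>c]] unfolding b_def integral_complex_of_real by simp
    have cc: "continuous_on UNIV c" unfolding c_def by (rule haarc[OF k(1)])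
    have b0: "0 \<le> b z" for z unfolding b_def using \<rho>(2) by simp
    have c0: "\<Phi> z0 = c z0"
    proof -
      have "\<Phi> z0 = (LINT x:rfib H (smap Z z0)|\<beta> (smap Z z0). k x)" unfolding \<Phi>_def
        using H.closed_rfib sets_beta[of z0] k(2) by (intro set_lebesgue_integral_cong) auto
      also have "\<dots> = c z0" unfolding c_def
        by (rule H.haar_integral_rfib[OF haar smap_in_units k(1)])
      finally show ?thesis .
    qed
    \<comment> \<open>With this \<open>\<delta>\<close>, the bound \<open>\<delta> * b z\<close> is at most \<open>e / 2\<close> once \<open>b z < b z0 + 1\<close>.\<close>
    define \<delta> where "\<delta> = e / (2 * (b z0 + 1))"
    have \<delta>: "0 < \<delta>" using e b0[of z0] by (simp add: \<delta>_def add_nonneg_pos)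
    define W where "W = {p \<in> ?D \<inter> N \<times> K2. \<delta> \<le> norm (f (ract Z (fst p) (snd p)) - k (snd p))}"
    have DNK: "compact (?D \<inter> N \<times> K2)"
      using closed_composable N K2 by (intro closed_Int_compact compact_Times)
    have contD: "continuous_on (?D \<inter> N \<times> K2) (\<lambda>p. norm (f (ract Z (fst p) (snd p)) - k (snd p)))"
    proof (intro continuous_intros)
      have "continuous_on (?D \<inter> N \<times> K2) (\<lambda>p. ract Z (fst p) (snd p))"
        using continuous_on_subset[OF continuous_ract, of "?D \<inter> N \<times> K2"] by (simp add: case_prod_beta')
      then show "continuous_on (?D \<inter> N \<times> K2) (\<lambda>p. f (ract Z (fst p) (snd p)))"
        by (rule continuous_on_compose2[of UNIV f, rotated]) (use f in \<open>auto simp: Cc_def\<close>)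
      show "continuous_on (?D \<inter> N \<times> K2) (\<lambda>p. k (snd p))"
        by (rule continuous_on_compose2[of UNIV k]) (use k in \<open>auto simp: Cc_def intro: continuous_on_snd\<close>)
    qed
    have "closedin (top_of_set (?D \<inter> N \<times> K2)) W"
      unfolding W_def using continuous_closedin_preimage[OF contD, of "{\<delta>..}"]
      by (simp add: vimage_def Int_def)
    then have "compact W" using DNK closedin_compact by blast
    then have "closed (fst ` W)"
      by (intro compact_imp_closed compact_continuous_image continuous_intros)
    moreover have "z0 \<notin> fst ` W"
      using k(2) \<delta> by (auto simp: W_def rfib_def)
    ultimately have ev1: "eventually (\<lambda>z. z \<in> N0 \<inter> (- fst ` W)) (nhds z0)"
      using N by (intro eventually_nhds_in_open) auto
    have tb: "(b \<longlongrightarrow> b z0) (nhds z0)" and tc: "(c \<longlongrightarrow> c z0) (nhds z0)"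
      using bc cc by (auto simp: continuous_on_eq_continuous_at isCont_def tendsto_at_iff_tendsto_nhds)
    have ev2: "eventually (\<lambda>z. b z < b z0 + 1) (nhds z0)"
      using tb by (intro order_tendstoD) auto
    have ev3: "eventually (\<lambda>z. dist (c z) (c z0) < e / 2) (nhds z0)"
      using tc e by (intro tendstoD) auto
    show ?thesis using ev1 ev2 ev3
    proof eventually_elim
      case (elim z)
      have zN: "z \<in> N" using elim N by auto
      have i1: "set_integrable (\<beta> (smap Z z)) (rfib H (smap Z z)) (\<lambda>x. f (ract Z z x))"
        by (rule set_integrable_closed_embedding[OF radon_beta orbit_embedding f])
      have i2: "set_integrable (\<beta> (smap Z z)) (rfib H (smap Z z)) k"
        using Cc_integrable[OF radon_beta k(1)] H.closed_rfib sets_beta[of z]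
        unfolding set_integrable_def by (intro integrable_mult_indicator) auto
      have "\<Phi> z - c z = (LINT x:rfib H (smap Z z)|\<beta> (smap Z z). f (ract Z z x) - k x)"
        unfolding \<Phi>_def c_def set_integral_diff(2)[OF i1 i2]
        using H.haar_integral_rfib[OF haar smap_in_units k(1)] by simp
      also have "norm \<dots> \<le> (\<integral>x. \<delta> * \<rho> x \<partial>\<beta> (smap Z z))"
        unfolding set_lebesgue_integral_def
      proof (rule order_trans[OF integral_norm_bound integral_mono])
        show "integrable (\<beta> (smap Z z)) (\<lambda>x. norm (indicator (rfib H (smap Z z)) x *\<^sub>R (f (ract Z z x) - k x)))"
          using set_integral_diff(1)[OF i1 i2] unfolding set_integrable_def by (rule integrable_norm)
        show "integrable (\<beta> (smap Z z)) (\<lambda>x. \<delta> * \<rho> x)" using int\<rho> by simp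
        fix x
        have "norm (f (ract Z z x) - k x) \<le> \<delta> * \<rho> x" if x: "smap Z z = rng H x"
        proof (cases "x \<in> K2")
          case True
          then have "norm (f (ract Z z x) - k x) < \<delta>"
            using elim zN x by (force simp: W_def)
          then show ?thesis using \<rho>(3)[OF True] by simp
        next
          case False
          then have "f (ract Z z x) = 0" "k x = 0" using K1f[OF zN x] kK2 by (auto simp: K2_def)
          then show ?thesis using \<delta> \<rho>(2)[of x] by simp
        qed
        then show "norm (indicator (rfib H (smap Z z)) x *\<^sub>R (f (ract Z z x) - k x)) \<le> \<delta> * \<rho> x"
          using \<delta> \<rho>(2)[of x] by (auto simp: indicator_def rfib_def)
      qed
      also have "\<dots> = \<delta> * b z" by (simp add: b_def)
      also have "\<dots> \<le> \<delta> * (b z0 + 1)" using elim \<delta> by simp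
      also have "\<dots> = e / 2" using b0[of z0] by (simp add: \<delta>_def field_simps)
      finally have "dist (\<Phi> z) (c z) \<le> e / 2" by (simp add: dist_norm)
      then show ?case using elim dist_triangle[of "\<Phi> z" "\<Phi> z0" "c z"] c0 by simp
    qed
  qed
  have "continuous_on UNIV \<Phi>"
    unfolding continuous_on_eq_continuous_at[OF open_UNIV] isCont_def tendsto_at_iff_tendsto_nhds
    using ev by (auto intro: tendstoI)
  then show ?thesis by (simp add: \<Phi>_def[abs_def])
qed

text \<open>
  The function \<open>z \<mapsto> \<integral> f d\<sigma>\<^sup>r\<^sup>(\<^sup>z\<^sup>)\<close> is continuous on \<open>Z\<close> by the preceding lemma. Since \<open>r\<close> is
  open and onto, the preimage of an open set in \<open>A\<close> is the image of an open set of \<open>Z\<close>.\<close>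

lemma continuous_sigma:
  fixes f :: "'z \<Rightarrow> complex"
  assumes f: "f \<in> Cc"
  shows "continuous_on A (\<lambda>u. \<integral>y. f y \<partial>\<sigma> u)"
  unfolding continuous_on_open
proof (intro allI impI)
  let ?\<Phi> = "\<lambda>z. LINT x:rfib H (smap Z z)|\<beta> (smap Z z). f (ract Z z x)"
  fix V assume "openin (top_of_set ((\<lambda>u. \<integral>y. f y \<partial>\<sigma> u) ` A)) V"
  then obtain V' where V': "open V'" "V = (\<lambda>u. \<integral>y. f y \<partial>\<sigma> u) ` A \<inter> V'"
    by (metis openin_open)
  have "open (?\<Phi> -` V')"
    using continuous_orbit_integral[OF f] V'(1) by (simp add: continuous_on_open_vimage[OF open_UNIV])
  then have "openin (top_of_set A) (rmap Z ` (?\<Phi> -` V'))"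
    using open_rmap by (simp add: open_map_def)
  also have "rmap Z ` (?\<Phi> -` V') = A \<inter> (\<lambda>u. \<integral>y. f y \<partial>\<sigma> u) -` V"
    using range_rmap by (auto simp: V' image_iff integral_sigma[OF f] simp del: split_paired_Ex)
  finally show "openin (top_of_set A) (A \<inter> (\<lambda>u. \<integral>y. f y \<partial>\<sigma> u) -` V)" .
qed

end

section \<open>The opposite space\<close>

lemma open_opp_iff: "open U \<longleftrightarrow> open (Bar -` U)"
  by (simp add: open_opp_def)

lemma open_vimage_unbar: "open U \<Longrightarrow> open (unbar -` U)"
  by (simp add: open_opp_iff vimage_def)

lemma continuous_Bar: "continuous_on S Bar"
  by (rule continuous_on_subset[of UNIV]) (auto simp: continuous_on_open_vimage open_opp_iff)

lemma continuous_unbar: "continuous_on S unbar"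
  by (rule continuous_on_subset[of UNIV]) (auto simp: continuous_on_open_vimage open_vimage_unbar)

instance opp :: (t2_space) t2_space
proof
  fix x y :: "'a opp" assume "x \<noteq> y"
  then have "unbar x \<noteq> unbar y" by (metis opp.collapse)
  then obtain U V where "open U" "open V" "unbar x \<in> U" "unbar y \<in> V" "U \<inter> V = {}"
    using hausdorff[of "unbar x" "unbar y"] by auto
  then show "\<exists>U V. open U \<and> open V \<and> x \<in> U \<and> y \<in> V \<and> U \<inter> V = {}"
    by (intro exI[of _ "unbar -` U"] exI[of _ "unbar -` V"]) (auto simp: open_vimage_unbar)
qed

lemma locally_compact_euclidean_iff:
  "locally_compact_space (euclidean :: 'a::topological_space topology) \<longleftrightarrow>
    (\<forall>x::'a. \<exists>U K. open U \<and> compact K \<and> x \<in> U \<and> U \<subseteq> K)"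
  by (simp add: locally_compact_space_def)

lemma locally_compact_opp:
  assumes "locally_compact_space (euclidean :: 'z::topological_space topology)"
  shows "locally_compact_space (euclidean :: 'z opp topology)"
  unfolding locally_compact_euclidean_iff
proof
  fix x :: "'z opp"
  obtain U K where "open U" "compact K" "unbar x \<in> U" "U \<subseteq> K"
    using assms unfolding locally_compact_euclidean_iff by blast
  then have "open (unbar -` U)" "compact (Bar ` K)" "x \<in> unbar -` U" "unbar -` U \<subseteq> Bar ` K"
    by (auto simp: open_vimage_unbar image_iff intro!: compact_continuous_image continuous_Bar)
      (metis opp.collapse subsetD)
  then show "\<exists>U K. open U \<and> compact K \<and> x \<in> U \<and> U \<subseteq> K" by blast
qed

section \<open>Equivalences as principal spaces\<close>

lemma induces_homeomorphismD:
  assumes "induces_homeomorphism q A f"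
  shows "range f = A" "f y = f z \<Longrightarrow> q y = q z"
proof -
  obtain h where h: "homeomorphic_map (quotient_topology q) (top_of_set A) h" "\<And>z. h (q z) = f z"
    using assms by (auto simp: induces_homeomorphism_def)
  have top: "topspace (quotient_topology q) = range q"
  proof
    show "topspace (quotient_topology q) \<subseteq> range q"
      using openin_topspace[of "quotient_topology q"] by (simp only: openin_quotient_topology)
    have "q -` range q = UNIV" by auto
    then have "openin (quotient_topology q) (range q)"
      by (simp only: openin_quotient_topology open_UNIV subset_refl simp_thms)
    then show "range q \<subseteq> topspace (quotient_topology q)" by (rule openin_subset)
  qed
  have h_range: "h ` range q = A"
    using homeomorphic_imp_surjective_map[OF h(1)] top by simp
  have h_inj: "inj_on h (range q)"
    using homeomorphic_imp_injective_map[OF h(1)] top by simp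
  show "range f = A" using h_range h(2) by (simp add: image_image)
  show "q y = q z" if "f y = f z"
    using inj_onD[OF h_inj, of "q y" "q z"] that h(2) by simp
qed

context groupoid_equivalence begin

lemma continuous_rmap: "continuous_on UNIV (rmap Z)"
  and rmap_in_units: "rmap Z z \<in> units G"
  and continuous_lact: "continuous_on {(x, z). src G x = rmap Z z} (\<lambda>(x, z). lact Z x z)"
  and rmap_lact: "src G x = rmap Z z \<Longrightarrow> rmap Z (lact Z x z) = rng G x"
  and lact_unit: "lact Z (rmap Z z) z = z"
  and lact_mul: "src G x = rng G y \<Longrightarrow> src G y = rmap Z z \<Longrightarrow> lact Z (mul G x y) z = lact Z x (lact Z y z)"
  using left_space by (auto simp: left_space_def continuous_map_in_subtopology)

lemma lact_inverse:
  assumes "src G x = rmap Z z"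
  shows "lact Z (ginv G x) (lact Z x z) = z"
  using lact_mul[of "ginv G x" x z] assms lact_unit[of z] by (simp add: G.src_inv G.mul_inv_left)

lemma continuous_smap: "continuous_on UNIV (smap Z)"
  and smap_in_units: "smap Z z \<in> units H"
  and continuous_ract: "continuous_on {(z, x). smap Z z = rng H x} (\<lambda>(z, x). ract Z z x)"
  and smap_ract: "smap Z z = rng H x \<Longrightarrow> smap Z (ract Z z x) = src H x"
  and ract_unit: "ract Z z (smap Z z) = z"
  and ract_mul: "smap Z z = rng H x \<Longrightarrow> src H x = rng H y \<Longrightarrow> ract Z z (mul H x y) = ract Z (ract Z z x) y"
  using right_space by (auto simp: right_space_def continuous_map_in_subtopology)

lemma ract_inverse:
  assumes "smap Z z = rng H x"
  shows "ract Z (ract Z z x) (ginv H x) = z"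
  using ract_mul[of z x "ginv H x"] assms ract_unit[of z] by (simp add: H.rng_inv H.mul_inv_right)

text \<open>
  The homeomorphism of \<open>Z/H\<close> with the units of \<open>G\<close> makes \<open>r\<close> a map onto these with the orbits as
  fibres; openness of \<open>r\<close> is part of the left action.\<close>

lemma principal_right: "principal_space H Z (units G)"
proof unfold_locales
  show "open_map euclidean (top_of_set (units G)) (rmap Z)"
    using left_space by (simp add: left_space_def)
  show "range (rmap Z) = units G" by (rule induces_homeomorphismD(1)[OF rmap_homeo])
  fix y z
  show "rmap Z y = rmap Z z \<longleftrightarrow> (\<exists>x. smap Z y = rng H x \<and> z = ract Z y x)"
  proof
    assume "rmap Z y = rmap Z z"
    then have "right_orbit H (smap Z) (ract Z) y = right_orbit H (smap Z) (ract Z) z"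
      by (rule induces_homeomorphismD(2)[OF rmap_homeo])
    moreover have "z \<in> right_orbit H (smap Z) (ract Z) z"
      unfolding right_orbit_def using ract_unit[of z] H.unit_simps(1)[OF smap_in_units[of z]]
      by (intro CollectI exI[of _ "smap Z z"]) auto
    ultimately show "\<exists>x. smap Z y = rng H x \<and> z = ract Z y x"
      by (auto simp: right_orbit_def)
  qed (auto simp: rmap_ract)
qed (use locally_compact_Z right_space right_free right_proper continuous_rmap in auto)

abbreviation "Zop \<equiv> opp_space G H Z"

lemma opp_simps [simp]:
  "rmap Zop w = smap Z (unbar w)" "smap Zop w = rmap Z (unbar w)"
  "lact Zop y w = Bar (ract Z (unbar w) (ginv H y))"
  "ract Zop w x = Bar (lact Z (ginv G x) (unbar w))"
  by (simp_all add: opp_space_def)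

lemma right_space_opp: "right_space G (smap Zop) (ract Zop)"
proof -
  have "continuous_map euclidean (top_of_set (units G)) (smap Zop)"
    using rmap_in_units continuous_on_compose2[OF continuous_rmap continuous_unbar]
    by (auto simp: continuous_map_in_subtopology opp_space_def)
  moreover have "open_map euclidean (top_of_set (units G)) (smap Zop)"
    unfolding open_map_def
  proof (intro allI impI)
    fix U :: "'z opp set" assume "openin euclidean U"
    then have "open (Bar -` U)" by (simp add: open_opp_iff)
    then have "openin (top_of_set (units G)) (rmap Z ` (Bar -` U))"
      using left_space by (simp add: left_space_def open_map_def)
    also have "rmap Z ` (Bar -` U) = smap Zop ` U"
      by (force simp: image_iff intro: rev_bexI)
    finally show "openin (top_of_set (units G)) (smap Zop ` U)" .
  qed
  moreover have "continuous_on {(w, x). smap Zop w = rng G x} (\<lambda>(w, x). ract Zop w x)"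
  proof -
    let ?D = "{(w, x). smap Zop w = rng G x}"
    have "continuous_on ?D (\<lambda>p. (ginv G (snd p), unbar (fst p)))"
      by (intro continuous_on_Pair continuous_on_compose2[OF G.continuous_inv]
          continuous_on_compose2[OF continuous_unbar[of UNIV]] continuous_on_fst continuous_on_snd continuous_on_id) auto
    then have "continuous_on ?D (\<lambda>p. (\<lambda>(x, z). lact Z x z) (ginv G (snd p), unbar (fst p)))"
      by (rule continuous_on_compose2[OF continuous_lact]) (auto simp: G.src_inv)
    then have "continuous_on ?D (\<lambda>p. Bar (lact Z (ginv G (snd p)) (unbar (fst p))))"
      by (intro continuous_on_compose2[OF continuous_Bar[of UNIV]]) auto
    then show ?thesis by (simp add: case_prod_beta')
  qed
  moreover have "ract Zop w (smap Zop w) = w" for w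
    using lact_unit[of "unbar w"] G.unit_simps(3)[OF rmap_in_units] by simp
  moreover have "smap Zop (ract Zop w x) = src G x" if "smap Zop w = rng G x" for w x
    using that by (simp add: rmap_lact G.src_inv G.rng_inv)
  moreover have "ract Zop w (mul G x y) = ract Zop (ract Zop w x) y"
    if "smap Zop w = rng G x" "src G x = rng G y" for w x y
    using that by (simp add: G.ginv_mul lact_mul G.src_inv G.rng_inv)
  ultimately show ?thesis unfolding right_space_def by blast
qed

lemma right_free_opp: "right_free G (smap Zop) (ract Zop)"
  unfolding right_free_def
proof (intro allI impI)
  fix w x assume a: "smap Zop w = rng G x \<and> ract Zop w x = w"
  then have "lact Z (ginv G x) (unbar w) = unbar w" by (metis opp.sel opp_simps(4))
  then have "ginv G x = rmap Z (unbar w)"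
    using left_free a unfolding left_free_def by (metis G.src_inv opp_simps(2))
  then show "x = smap Zop w"
    using G.unit_simps(3)[OF rmap_in_units] G.ginv_ginv[of x] by simp
qed

text \<open>
  Up to the homeomorphisms \<open>\<phi>\<close> and \<open>Bar \<times> Bar\<close>, this is the map whose properness is
  known for the left action of \<open>G\<close> on \<open>Z\<close>.\<close>

lemma right_proper_opp: "right_proper G (smap Zop) (ract Zop)"
proof -
  let ?D = "{(w, x). smap Zop w = rng G x}" and ?E = "{(x, z). src G x = rmap Z z}"
  let ?\<phi> = "\<lambda>p. (ginv G (snd p), unbar (fst p))" and ?\<phi>' = "\<lambda>p. (Bar (snd p), ginv G (fst p))"
  have "homeomorphic_maps (top_of_set ?D) (top_of_set ?E) ?\<phi> ?\<phi>'"
    unfolding homeomorphic_maps_def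
  proof (intro conjI)
    show "continuous_map (top_of_set ?D) (top_of_set ?E) ?\<phi>"
      by (auto simp: continuous_map_in_subtopology G.src_inv
          intro!: continuous_on_Pair continuous_on_compose2[OF G.continuous_inv]
          continuous_on_compose2[OF continuous_unbar[of UNIV]] continuous_on_fst continuous_on_snd continuous_on_id)
    show "continuous_map (top_of_set ?E) (top_of_set ?D) ?\<phi>'"
      by (auto simp: continuous_map_in_subtopology G.rng_inv
          intro!: continuous_on_Pair continuous_on_compose2[OF G.continuous_inv]
          continuous_on_compose2[OF continuous_Bar[of UNIV]] continuous_on_fst continuous_on_snd continuous_on_id)
  qed (auto simp: G.ginv_ginv)
  then have 1: "proper_map (top_of_set ?D) (top_of_set ?E) ?\<phi>"
    using homeomorphic_imp_proper_map homeomorphic_map_maps by blast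
  have "homeomorphic_maps (euclidean :: ('z \<times> 'z) topology) (euclidean :: ('z opp \<times> 'z opp) topology)
      (map_prod Bar Bar) (map_prod unbar unbar)"
    unfolding homeomorphic_maps_def
    by (auto simp: map_prod_def case_prod_beta'
        intro!: continuous_on_Pair continuous_on_compose2[OF continuous_Bar[of UNIV]]
          continuous_on_compose2[OF continuous_unbar[of UNIV]] continuous_on_fst continuous_on_snd continuous_on_id)
  then have 3: "proper_map (euclidean :: ('z \<times> 'z) topology) (euclidean :: ('z opp \<times> 'z opp) topology) (map_prod Bar Bar)"
    using homeomorphic_imp_proper_map homeomorphic_map_maps by blast
  have "proper_map (top_of_set ?D) euclidean
      (map_prod Bar Bar \<circ> ((\<lambda>(x, z). (lact Z x z, z)) \<circ> ?\<phi>))"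
    using left_proper unfolding left_proper_def
    by (intro proper_map_compose[OF proper_map_compose[OF 1] 3])
  moreover have "map_prod Bar Bar \<circ> ((\<lambda>(x, z). (lact Z x z, z)) \<circ> ?\<phi>) = (\<lambda>(w, x). (ract Zop w x, w))"
    by (auto simp: fun_eq_iff)
  ultimately show ?thesis by (simp add: right_proper_def)
qed

lemma principal_opp: "principal_space G Zop (units H)"
proof unfold_locales
  show "continuous_on UNIV (rmap Zop)"
    using continuous_on_compose2[OF continuous_smap continuous_unbar[of UNIV]] by (simp add: opp_space_def)
  show "open_map euclidean (top_of_set (units H)) (rmap Zop)"
    unfolding open_map_def
  proof (intro allI impI)
    fix U :: "'z opp set" assume "openin euclidean U"
    then have "open (Bar -` U)" by (simp add: open_opp_iff)
    then have "openin (top_of_set (units H)) (smap Z ` (Bar -` U))"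
      using right_space by (simp add: right_space_def open_map_def)
    also have "smap Z ` (Bar -` U) = rmap Zop ` U"
      by (force simp: image_iff intro: rev_bexI)
    finally show "openin (top_of_set (units H)) (rmap Zop ` U)" .
  qed
  have "range (rmap Zop) = range (smap Z)"
    by (auto simp: image_iff) (metis opp.sel)
  then show "range (rmap Zop) = units H"
    using induces_homeomorphismD(1)[OF smap_homeo] by simp
  fix w w'
  show "rmap Zop w = rmap Zop w' \<longleftrightarrow> (\<exists>x. smap Zop w = rng G x \<and> w' = ract Zop w x)"
  proof
    assume "rmap Zop w = rmap Zop w'"
    then have "left_orbit G (rmap Z) (lact Z) (unbar w) = left_orbit G (rmap Z) (lact Z) (unbar w')"
      by (intro induces_homeomorphismD(2)[OF smap_homeo]) simp
    moreover have "unbar w' \<in> left_orbit G (rmap Z) (lact Z) (unbar w')"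
      unfolding left_orbit_def using lact_unit[of "unbar w'"] G.unit_simps(2)[OF rmap_in_units]
      by (intro CollectI exI[of _ "rmap Z (unbar w')"]) auto
    ultimately obtain x where x: "src G x = rmap Z (unbar w)" "unbar w' = lact Z x (unbar w)"
      by (auto simp: left_orbit_def)
    then show "\<exists>x. smap Zop w = rng G x \<and> w' = ract Zop w x"
      by (intro exI[of _ "ginv G x"]) (auto simp: G.rng_inv G.ginv_ginv opp.expand)
  qed (auto simp: smap_lact G.src_inv)
qed (use locally_compact_opp[OF locally_compact_Z] right_space_opp right_free_opp right_proper_opp in auto)

text \<open>
  Both sides denote the \<open>x\<close> with \<open>x\<cdot>unbar w = z\<close>. This brings the product of \<open>Z\<close> with the opposite
  space into the scope of the results on principal spaces.\<close>

lemma lbracket_eq_rbracket_opp: "lbracket G Z z (unbar w) = rbracket G Zop (Bar z) w"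
proof -
  have "src G x = rmap Z (unbar w) \<and> lact Z x (unbar w) = z \<longleftrightarrow>
      smap Zop (Bar z) = rng G x \<and> ract Zop (Bar z) x = w" for x
  proof
    assume "src G x = rmap Z (unbar w) \<and> lact Z x (unbar w) = z"
    then show "smap Zop (Bar z) = rng G x \<and> ract Zop (Bar z) x = w"
      by (auto simp: rmap_lact lact_inverse)
  next
    assume "smap Zop (Bar z) = rng G x \<and> ract Zop (Bar z) x = w"
    then show "src G x = rmap Z (unbar w) \<and> lact Z x (unbar w) = z"
      using lact_inverse[of "ginv G x" z]
      by (auto simp: rmap_lact G.ginv_ginv G.src_inv G.rng_inv)
  qed
  then show ?thesis unfolding lbracket_def rbracket_def by simp
qed

lemma lact_embedding: "closed_embedding {z. rmap Z z = src G x} (lact Z x)"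
proof (rule closed_embeddingI_inverse[where g = "lact Z (ginv G x)"])
  interpret R: principal_space H Z "units G" by (rule principal_right)
  have cont: "continuous_on {z. rmap Z z = src G x} (lact Z x)" for x
  proof -
    have "continuous_on {z. rmap Z z = src G x} (\<lambda>z. case (x, z) of (x, z) \<Rightarrow> lact Z x z)"
      by (rule continuous_on_compose2[OF continuous_lact])
        (auto intro!: continuous_on_Pair continuous_on_const continuous_on_id)
    then show ?thesis by simp
  qed
  have im: "lact Z x ` {z. rmap Z z = src G x} = {z. rmap Z z = rng G x}"
  proof
    show "{z. rmap Z z = rng G x} \<subseteq> lact Z x ` {z. rmap Z z = src G x}"
    proof
      fix z assume "z \<in> {z. rmap Z z = rng G x}"
      then show "z \<in> lact Z x ` {z. rmap Z z = src G x}"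
        using lact_inverse[of "ginv G x" z]
        by (intro image_eqI[of _ _ "lact Z (ginv G x) z"]) (auto simp: G.ginv_ginv G.src_inv G.rng_inv rmap_lact)
    qed
  qed (auto simp: rmap_lact)
  show "closed {z. rmap Z z = src G x}" by (rule R.closed_fibre)
  show "closed (lact Z x ` {z. rmap Z z = src G x})" unfolding im by (rule R.closed_fibre)
  show "continuous_on {z. rmap Z z = src G x} (lact Z x)" by (rule cont)
  show "continuous_on (lact Z x ` {z. rmap Z z = src G x}) (lact Z (ginv G x))"
    using cont[of "ginv G x"] unfolding im by (simp add: G.src_inv)
qed (auto simp: lact_inverse)

lemma lact_opp_embedding: "closed_embedding {w. rmap Zop w = src H y} (lact Zop y)"
proof (rule closed_embeddingI_inverse[where g = "lact Zop (ginv H y)"])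
  interpret R: principal_space G Zop "units H" by (rule principal_opp)
  have cont: "continuous_on {w. rmap Zop w = src H y} (lact Zop y)" for y
  proof -
    have "continuous_on {w. rmap Zop w = src H y} (\<lambda>w. case (unbar w, ginv H y) of (z, x) \<Rightarrow> ract Z z x)"
      by (rule continuous_on_compose2[OF continuous_ract])
        (auto intro!: continuous_on_Pair continuous_on_const continuous_unbar simp: H.rng_inv)
    then have "continuous_on {w. rmap Zop w = src H y} (\<lambda>w. Bar (ract Z (unbar w) (ginv H y)))"
      by (intro continuous_on_compose2[OF continuous_Bar[of UNIV]]) auto
    then show ?thesis by (simp add: opp_space_def)
  qed
  have inv: "lact Zop (ginv H y) (lact Zop y w) = w" if "rmap Zop w = src H y" for y w
    using that ract_inverse[of "unbar w" "ginv H y"] by (simp add: H.rng_inv)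
  have sub: "rmap Zop (lact Zop y w) = rng H y" if "rmap Zop w = src H y" for y w
    using that by (simp add: smap_ract H.rng_inv H.src_inv)
  have im: "lact Zop y ` {w. rmap Zop w = src H y} = {w. rmap Zop w = rng H y}"
  proof
    show "{w. rmap Zop w = rng H y} \<subseteq> lact Zop y ` {w. rmap Zop w = src H y}"
    proof
      fix w assume "w \<in> {w. rmap Zop w = rng H y}"
      then have w: "rmap Zop w = src H (ginv H y)" by (simp add: H.src_inv)
      show "w \<in> lact Zop y ` {w. rmap Zop w = src H y}"
        using inv[OF w] sub[OF w] unfolding H.ginv_ginv H.rng_inv
        by (intro image_eqI[of _ _ "lact Zop (ginv H y) w"]) (simp_all only: mem_Collect_eq)
    qed
  qed (use sub in blast)
  show "closed {w. rmap Zop w = src H y}" by (rule R.closed_fibre)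
  show "closed (lact Zop y ` {w. rmap Zop w = src H y})" unfolding im by (rule R.closed_fibre)
  show "continuous_on {w. rmap Zop w = src H y} (lact Zop y)" by (rule cont)
  show "continuous_on (lact Zop y ` {w. rmap Zop w = src H y}) (lact Zop (ginv H y))"
    using cont[of "ginv H y"] unfolding im by (simp only: H.src_inv)
  show "lact Zop (ginv H y) (lact Zop y w) = w" if "w \<in> {w. rmap Zop w = src H y}" for w
    using that inv by blast
qed

end

section \<open>The topology of the linking groupoid\<close>

lemma open_linking_image:
  "open U \<Longrightarrow> open (InG ` U)" "open V \<Longrightarrow> open (InZ ` V)"
  "open W \<Longrightarrow> open (InOp ` W)" "open X \<Longrightarrow> open (InH ` X)"
proof -
  have [simp]: "InG -` InG ` U = U" "InZ -` InZ ` V = V" "InOp -` InOp ` W = W" "InH -` InH ` X = X"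
    by auto
  have [simp]: "InG -` InZ ` V = {}" "InG -` InOp ` W = {}" "InG -` InH ` X = {}"
    "InZ -` InG ` U = {}" "InZ -` InOp ` W = {}" "InZ -` InH ` X = {}"
    "InOp -` InG ` U = {}" "InOp -` InZ ` V = {}" "InOp -` InH ` X = {}"
    "InH -` InG ` U = {}" "InH -` InZ ` V = {}" "InH -` InOp ` W = {}"
    by auto
  show "open U \<Longrightarrow> open (InG ` U)" "open V \<Longrightarrow> open (InZ ` V)"
    "open W \<Longrightarrow> open (InOp ` W)" "open X \<Longrightarrow> open (InH ` X)"
    by (simp_all add: open_linking_def)
qed

lemma linking_embeddings:
  "closed_embedding UNIV (InG :: 'a \<Rightarrow> ('a::topological_space, 'b::topological_space, 'c::topological_space) linking)"
  "closed_embedding UNIV (InZ :: 'b \<Rightarrow> ('a, 'b, 'c) linking)"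
  "closed_embedding UNIV (InOp :: 'b opp \<Rightarrow> ('a, 'b, 'c) linking)"
  "closed_embedding UNIV (InH :: 'c \<Rightarrow> ('a, 'b, 'c) linking)"
proof -
  have vimage: "InG -` (- InG ` C1) = - C1" "InZ -` (- InZ ` C2) = - C2"
    "InOp -` (- InOp ` C3) = - C3" "InH -` (- InH ` C4) = - C4"
    "InG -` (- InZ ` C2) = UNIV" "InG -` (- InOp ` C3) = UNIV" "InG -` (- InH ` C4) = UNIV"
    "InZ -` (- InG ` C1) = UNIV" "InZ -` (- InOp ` C3) = UNIV" "InZ -` (- InH ` C4) = UNIV"
    "InOp -` (- InG ` C1) = UNIV" "InOp -` (- InZ ` C2) = UNIV" "InOp -` (- InH ` C4) = UNIV"
    "InH -` (- InG ` C1) = UNIV" "InH -` (- InZ ` C2) = UNIV" "InH -` (- InOp ` C3) = UNIV" for C1 C2 C3 C4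
    by auto
  show "closed_embedding UNIV (InG :: 'a \<Rightarrow> ('a, 'b, 'c) linking)"
    "closed_embedding UNIV (InZ :: 'b \<Rightarrow> ('a, 'b, 'c) linking)"
    "closed_embedding UNIV (InOp :: 'b opp \<Rightarrow> ('a, 'b, 'c) linking)"
    "closed_embedding UNIV (InH :: 'c \<Rightarrow> ('a, 'b, 'c) linking)"
    by (rule closed_embeddingI;
        simp add: continuous_on_open_vimage open_linking_def closed_def inj_def vimage)+
qed

lemma hausdorff_open_embedding:
  fixes k :: "'d::t2_space \<Rightarrow> 'e::topological_space"
  assumes k: "inj k" "\<And>U. open U \<Longrightarrow> open (k ` U)" and ab: "a \<noteq> b"
  shows "\<exists>U V. open U \<and> open V \<and> k a \<in> U \<and> k b \<in> V \<and> U \<inter> V = {}"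
proof -
  obtain U V where "open U" "open V" "a \<in> U" "b \<in> V" "U \<inter> V = {}"
    using hausdorff[OF ab] by auto
  then show ?thesis
    using k by (intro exI[of _ "k ` U"] exI[of _ "k ` V"]) (auto simp: inj_def)
qed

instance linking :: (t2_space, t2_space, t2_space) t2_space
proof
  fix x y :: "('a, 'b, 'c) linking" assume xy: "x \<noteq> y"
  have diff: "\<exists>U V. open U \<and> open V \<and> x \<in> U \<and> y \<in> V \<and> U \<inter> V = {}"
    if "open U" "x \<in> U" "open V" "y \<in> V" "U \<inter> V = {}" for U V
    using that by blast
  note ranges = open_linking_image[OF open_UNIV]
  show "\<exists>U V. open U \<and> open V \<and> x \<in> U \<and> y \<in> V \<and> U \<inter> V = {}"
  proof (cases x)
    case x: (InG a)
    show ?thesis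
    proof (cases y)
      case (InG b)
      with x xy show ?thesis
        using hausdorff_open_embedding[of InG a b] open_linking_image(1) by (auto simp: inj_def)
    next
      case (InZ b) then show ?thesis using x by (intro diff[OF ranges(1) _ ranges(2)]) auto
    next
      case (InOp b) then show ?thesis using x by (intro diff[OF ranges(1) _ ranges(3)]) auto
    next
      case (InH b) then show ?thesis using x by (intro diff[OF ranges(1) _ ranges(4)]) auto
    qed
  next
    case x: (InZ a)
    show ?thesis
    proof (cases y)
      case (InZ b)
      with x xy show ?thesis
        using hausdorff_open_embedding[of InZ a b] open_linking_image(2) by (auto simp: inj_def)
    next
      case (InG b) then show ?thesis using x by (intro diff[OF ranges(2) _ ranges(1)]) auto
    next
      case (InOp b) then show ?thesis using x by (intro diff[OF ranges(2) _ ranges(3)]) auto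
    next
      case (InH b) then show ?thesis using x by (intro diff[OF ranges(2) _ ranges(4)]) auto
    qed
  next
    case x: (InOp a)
    show ?thesis
    proof (cases y)
      case (InOp b)
      with x xy show ?thesis
        using hausdorff_open_embedding[of InOp a b] open_linking_image(3) by (auto simp: inj_def)
    next
      case (InG b) then show ?thesis using x by (intro diff[OF ranges(3) _ ranges(1)]) auto
    next
      case (InZ b) then show ?thesis using x by (intro diff[OF ranges(3) _ ranges(2)]) auto
    next
      case (InH b) then show ?thesis using x by (intro diff[OF ranges(3) _ ranges(4)]) auto
    qed
  next
    case x: (InH a)
    show ?thesis
    proof (cases y)
      case (InH b)
      with x xy show ?thesis
        using hausdorff_open_embedding[of InH a b] open_linking_image(4) by (auto simp: inj_def)
    next
      case (InG b) then show ?thesis using x by (intro diff[OF ranges(4) _ ranges(1)]) auto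
    next
      case (InZ b) then show ?thesis using x by (intro diff[OF ranges(4) _ ranges(2)]) auto
    next
      case (InOp b) then show ?thesis using x by (intro diff[OF ranges(4) _ ranges(3)]) auto
    qed
  qed
qed

lemma locally_compact_open_embedding:
  fixes k :: "'d::topological_space \<Rightarrow> 'e::topological_space"
  assumes lc: "locally_compact_space (euclidean :: 'd topology)"
    and k: "\<And>U. open U \<Longrightarrow> open (k ` U)" "continuous_on UNIV k"
  shows "\<exists>U K. open U \<and> compact K \<and> k a \<in> U \<and> U \<subseteq> K"
proof -
  obtain U K where "open U" "compact K" "a \<in> U" "U \<subseteq> K"
    using lc unfolding locally_compact_euclidean_iff by blast
  then show ?thesis
    using k by (intro exI[of _ "k ` U"] exI[of _ "k ` K"])
      (auto intro: compact_continuous_image continuous_on_subset)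
qed

lemma locally_compact_linking:
  assumes "locally_compact_space (euclidean :: 'a::topological_space topology)"
    "locally_compact_space (euclidean :: 'b::topological_space topology)"
    "locally_compact_space (euclidean :: 'c::topological_space topology)"
  shows "locally_compact_space (euclidean :: ('a, 'b, 'c) linking topology)"
  unfolding locally_compact_euclidean_iff
proof
  fix x :: "('a, 'b, 'c) linking"
  note e = linking_embeddings[THEN closed_embeddingD(3)]
  show "\<exists>U K. open U \<and> compact K \<and> x \<in> U \<and> U \<subseteq> K"
  proof (cases x)
    case (InG a) then show ?thesis
      using locally_compact_open_embedding[OF assms(1) open_linking_image(1) e(1)] by simp
  next
    case (InZ a) then show ?thesis
      using locally_compact_open_embedding[OF assms(2) open_linking_image(2) e(2)] by simp
  next
    case (InOp a) then show ?thesis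
      using locally_compact_open_embedding[OF locally_compact_opp[OF assms(2)] open_linking_image(3) e(3)] by simp
  next
    case (InH a) then show ?thesis
      using locally_compact_open_embedding[OF assms(3) open_linking_image(4) e(4)] by simp
  qed
qed

section \<open>The Haar system of the linking groupoid\<close>

locale equivalence_haar = groupoid_equivalence G H Z
  for G :: "'g::{second_countable_topology, t2_space} groupoid"
    and H :: "'h::{second_countable_topology, t2_space} groupoid"
    and Z :: "('g, 'z::{second_countable_topology, t2_space}, 'h) bispace" +
  fixes \<alpha> :: "'g \<Rightarrow> 'g measure" and \<beta> :: "'h \<Rightarrow> 'h measure"
  assumes haar_G: "haar_system G \<alpha>" and haar_H: "haar_system H \<beta>"
begin

sublocale R: principal_haar_space H Z "units G" \<beta>
  by (intro principal_haar_space.intro principal_right principal_haar_space_axioms.intro haar_H)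

sublocale Op: principal_haar_space G Zop "units H" \<alpha>
  by (intro principal_haar_space.intro principal_opp principal_haar_space_axioms.intro haar_G)

abbreviation "LG \<equiv> linking_groupoid G H Z"
abbreviation "\<kappa> \<equiv> kappa G H Z \<alpha> \<beta>"

lemma LG_simps [simp]:
  "rng LG = link_rng G H Z" "src LG = link_src G H Z" "mul LG = link_mul G H Z"
  by (simp_all add: linking_groupoid_def)

lemma units_LG: "units LG = InG ` units G \<union> InH ` units H"
proof
  show "units LG \<subseteq> InG ` units G \<union> InH ` units H"
  proof
    fix w assume "w \<in> units LG"
    then obtain x where "w = link_rng G H Z x" by (auto simp: units_def)
    then show "w \<in> InG ` units G \<union> InH ` units H"
      using G.rng_in_units H.rng_in_units rmap_in_units smap_in_units by (cases x) auto
  qed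
  show "InG ` units G \<union> InH ` units H \<subseteq> units LG"
  proof -
    have "InG (rng G x) \<in> range (link_rng G H Z)" "InH (rng H y) \<in> range (link_rng G H Z)" for x y
      using rangeI[of "link_rng G H Z" "InG x"] rangeI[of "link_rng G H Z" "InH y"] by simp_all
    then show ?thesis unfolding units_def LG_simps by blast
  qed
qed

lemma rfib_LG:
  "rfib LG (InG u) = InG ` rfib G u \<union> InZ ` {z. rmap Z z = u}"
  "rfib LG (InH v) = InOp ` {w. rmap Zop w = v} \<union> InH ` rfib H v"
proof -
  have "x \<in> rfib LG (InG u) \<longleftrightarrow> x \<in> InG ` rfib G u \<union> InZ ` {z. rmap Z z = u}" for x
    unfolding rfib_def LG_simps by (cases x) auto
  then show "rfib LG (InG u) = InG ` rfib G u \<union> InZ ` {z. rmap Z z = u}" by blast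
  have "x \<in> rfib LG (InH v) \<longleftrightarrow> x \<in> InOp ` {w. rmap Zop w = v} \<union> InH ` rfib H v" for x
    unfolding rfib_def LG_simps by (cases x) auto
  then show "rfib LG (InH v) = InOp ` {w. rmap Zop w = v} \<union> InH ` rfib H v" by blast
qed

lemma locally_compact_LG: "locally_compact_space (euclidean :: ('g, 'z, 'h) linking topology)"
  by (intro locally_compact_linking G.locally_compact H.locally_compact locally_compact_Z)

abbreviation "glue\<^sub>G u \<equiv> disjoint_embeddings.glue InG InZ (\<alpha> u) (R.\<sigma> u)"
abbreviation "glue\<^sub>H v \<equiv> disjoint_embeddings.glue InOp InH (Op.\<sigma> v) (\<beta> v)"

lemma disjoint_embeddings_G:
  "u \<in> units G \<Longrightarrow> disjoint_embeddings InG (InZ :: 'z \<Rightarrow> ('g, 'z, 'h) linking) (\<alpha> u) (R.\<sigma> u)"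
  using haar_systemD(1)[OF haar_G] R.sigma_radon linking_embeddings by unfold_locales auto

lemma disjoint_embeddings_H:
  "v \<in> units H \<Longrightarrow> disjoint_embeddings InOp (InH :: 'h \<Rightarrow> ('g, 'z, 'h) linking) (Op.\<sigma> v) (\<beta> v)"
  using haar_systemD(1)[OF haar_H] Op.sigma_radon linking_embeddings by unfold_locales auto

lemma kappa_eqI:
  assumes "radon_measure M" "\<And>F. F \<in> Cc \<Longrightarrow> (\<integral>x. F x \<partial>M) = kappa_functional G H Z \<alpha> \<beta> w F"
  shows "\<kappa> w = M"
  unfolding kappa_def
  using assms by (intro the_equality) (auto intro!: radon_measure_eqI[OF locally_compact_LG])

lemma kappa_InG:
  assumes u: "u \<in> units G"
  shows "\<kappa> (InG u) = glue\<^sub>G u"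
proof -
  interpret D: disjoint_embeddings InG "InZ :: 'z \<Rightarrow> ('g, 'z, 'h) linking" "\<alpha> u" "R.\<sigma> u"
    by (rule disjoint_embeddings_G[OF u])
  show ?thesis by (rule kappa_eqI[OF D.radon_glue]) (simp add: D.integral_glue)
qed

lemma kappa_InH:
  assumes v: "v \<in> units H"
  shows "\<kappa> (InH v) = glue\<^sub>H v"
proof -
  interpret D: disjoint_embeddings InOp "InH :: 'h \<Rightarrow> ('g, 'z, 'h) linking" "Op.\<sigma> v" "\<beta> v"
    by (rule disjoint_embeddings_H[OF v])
  show ?thesis by (rule kappa_eqI[OF D.radon_glue]) (simp add: D.integral_glue)
qed

lemma kappa_radon_msupp:
  assumes "w \<in> units LG"
  shows "radon_measure (\<kappa> w) \<and> msupp (\<kappa> w) = rfib LG w"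
proof -
  consider u where "u \<in> units G" "w = InG u" | v where "v \<in> units H" "w = InH v"
    using assms unfolding units_LG by blast
  then show ?thesis
  proof cases
    case (1 u)
    interpret D: disjoint_embeddings InG "InZ :: 'z \<Rightarrow> ('g, 'z, 'h) linking" "\<alpha> u" "R.\<sigma> u"
      by (rule disjoint_embeddings_G[OF 1(1)])
    show ?thesis unfolding 1(2) kappa_InG[OF 1(1)] rfib_LG
      using D.radon_glue D.msupp_glue haar_systemD(2)[OF haar_G 1(1)] R.msupp_sigma[OF 1(1)] by simp
  next
    case (2 v)
    interpret D: disjoint_embeddings InOp "InH :: 'h \<Rightarrow> ('g, 'z, 'h) linking" "Op.\<sigma> v" "\<beta> v"
      by (rule disjoint_embeddings_H[OF 2(1)])
    show ?thesis unfolding 2(2) kappa_InH[OF 2(1)] rfib_LG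
      using D.radon_glue D.msupp_glue haar_systemD(2)[OF haar_H 2(1)] Op.msupp_sigma[OF 2(1)] by simp
  qed
qed

lemma integral_kappa:
  assumes F: "F \<in> Cc"
  shows "u \<in> units G \<Longrightarrow> (\<integral>x. F x \<partial>\<kappa> (InG u)) = (\<integral>x. F (InG x) \<partial>\<alpha> u) + (\<integral>z. F (InZ z) \<partial>R.\<sigma> u)"
    and "v \<in> units H \<Longrightarrow> (\<integral>x. F x \<partial>\<kappa> (InH v)) = (\<integral>w. F (InOp w) \<partial>Op.\<sigma> v) + (\<integral>y. F (InH y) \<partial>\<beta> v)"
  using disjoint_embeddings.integral_glue[OF disjoint_embeddings_G F]
    disjoint_embeddings.integral_glue[OF disjoint_embeddings_H F]
  by (simp_all add: kappa_InG kappa_InH)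

lemma Cc_pieces:
  assumes F: "(F :: ('g, 'z, 'h) linking \<Rightarrow> complex) \<in> Cc"
  shows "(\<lambda>x. F (InG x)) \<in> Cc" "(\<lambda>z. F (InZ z)) \<in> Cc" "(\<lambda>w. F (InOp w)) \<in> Cc" "(\<lambda>y. F (InH y)) \<in> Cc"
  by (rule Cc_comp_closed_embedding[OF linking_embeddings(1) F] Cc_comp_closed_embedding[OF linking_embeddings(2) F]
      Cc_comp_closed_embedding[OF linking_embeddings(3) F] Cc_comp_closed_embedding[OF linking_embeddings(4) F])+

lemma continuous_kappa:
  assumes F: "F \<in> Cc"
  shows "continuous_on (units LG) (\<lambda>w. \<integral>x. F x \<partial>\<kappa> w)"
  unfolding units_LG
proof (rule continuous_on_image_Un[OF linking_embeddings(1,4)])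
  show "closed (units G)" by (rule G.closed_units)
  show "closed (units H)" by (rule H.closed_units)
  have "continuous_on (units G) (\<lambda>u. (\<integral>x. F (InG x) \<partial>\<alpha> u) + (\<integral>z. F (InZ z) \<partial>R.\<sigma> u))"
    using haar_G Cc_pieces(1)[OF F] R.continuous_sigma[OF Cc_pieces(2)[OF F]]
    by (intro continuous_on_add) (auto simp: haar_system_def)
  then show "continuous_on (units G) (\<lambda>u. \<integral>x. F x \<partial>\<kappa> (InG u))"
    by (rule continuous_on_eq) (simp add: integral_kappa[OF F])
  have "continuous_on (units H) (\<lambda>v. (\<integral>w. F (InOp w) \<partial>Op.\<sigma> v) + (\<integral>y. F (InH y) \<partial>\<beta> v))"
    using haar_H Cc_pieces(4)[OF F] Op.continuous_sigma[OF Cc_pieces(3)[OF F]]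
    by (intro continuous_on_add) (auto simp: haar_system_def)
  then show "continuous_on (units H) (\<lambda>v. \<integral>x. F x \<partial>\<kappa> (InH v))"
    by (rule continuous_on_eq) (simp add: integral_kappa[OF F])
qed

text \<open>
  In applications \<open>h\<close> is \<open>y \<mapsto> F(xy)\<close>, and \<open>e\<close> and \<open>d\<close> are the restrictions of the left
  multiplication by \<open>x\<close> to the two pieces of the fibre.\<close>

lemma set_integral_kappa_G:
  fixes h :: "('g, 'z, 'h) linking \<Rightarrow> complex"
  assumes u: "u \<in> units G"
    and e: "closed_embedding (rfib G u) e" "f \<in> Cc" "\<And>a. a \<in> rfib G u \<Longrightarrow> h (InG a) = f (e a)"
    and d: "closed_embedding {z. rmap Z z = u} d" "k \<in> Cc" "\<And>z. rmap Z z = u \<Longrightarrow> h (InZ z) = k (d z)"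
  shows "(LINT x:rfib LG (InG u)|\<kappa> (InG u). h x) =
    (LINT a:rfib G u|\<alpha> u. f (e a)) + (LINT z:{z. rmap Z z = u}|R.\<sigma> u. k (d z))"
proof -
  interpret D: disjoint_embeddings InG "InZ :: 'z \<Rightarrow> ('g, 'z, 'h) linking" "\<alpha> u" "R.\<sigma> u"
    by (rule disjoint_embeddings_G[OF u])
  have 1: "continuous_on (rfib G u) (\<lambda>a. h (InG a))"
    by (rule continuous_on_eq[OF Cc_closed_embedding(1)[OF e(1,2)]]) (simp add: e(3))
  have 2: "continuous_on {z. rmap Z z = u} (\<lambda>z. h (InZ z))"
    by (rule continuous_on_eq[OF Cc_closed_embedding(1)[OF d(1,2)]]) (simp add: d(3))
  have 3: "set_integrable (\<alpha> u) (rfib G u) (\<lambda>a. h (InG a))"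
    using set_integrable_closed_embedding[OF D.M e(1,2)] e(3)
    by (subst set_integrable_cong[OF refl refl e(3)])
  have 4: "set_integrable (R.\<sigma> u) {z. rmap Z z = u} (\<lambda>z. h (InZ z))"
    using set_integrable_closed_embedding[OF D.N d(1,2)] d(3)
    by (subst set_integrable_cong[OF refl refl, where f' = "\<lambda>z. k (d z)"]) auto
  have "(LINT x:rfib LG (InG u)|\<kappa> (InG u). h x) =
      (LINT a:rfib G u|\<alpha> u. h (InG a)) + (LINT z:{z. rmap Z z = u}|R.\<sigma> u. h (InZ z))"
    unfolding rfib_LG kappa_InG[OF u]
    by (rule D.set_integral_glue[OF G.closed_rfib 1 3 R.closed_fibre 2 4])
  also have "(LINT a:rfib G u|\<alpha> u. h (InG a)) = (LINT a:rfib G u|\<alpha> u. f (e a))"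
    using e(3) G.closed_rfib D.sets_M by (intro set_lebesgue_integral_cong) auto
  also have "(LINT z:{z. rmap Z z = u}|R.\<sigma> u. h (InZ z)) = (LINT z:{z. rmap Z z = u}|R.\<sigma> u. k (d z))"
    using d(3) R.closed_fibre D.sets_N by (intro set_lebesgue_integral_cong) auto
  finally show ?thesis .
qed

lemma set_integral_kappa_H:
  fixes h :: "('g, 'z, 'h) linking \<Rightarrow> complex"
  assumes v: "v \<in> units H"
    and d: "closed_embedding {w. rmap Zop w = v} d" "k \<in> Cc" "\<And>w. rmap Zop w = v \<Longrightarrow> h (InOp w) = k (d w)"
    and e: "closed_embedding (rfib H v) e" "f \<in> Cc" "\<And>a. a \<in> rfib H v \<Longrightarrow> h (InH a) = f (e a)"
  shows "(LINT x:rfib LG (InH v)|\<kappa> (InH v). h x) =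
    (LINT w:{w. rmap Zop w = v}|Op.\<sigma> v. k (d w)) + (LINT a:rfib H v|\<beta> v. f (e a))"
proof -
  interpret D: disjoint_embeddings InOp "InH :: 'h \<Rightarrow> ('g, 'z, 'h) linking" "Op.\<sigma> v" "\<beta> v"
    by (rule disjoint_embeddings_H[OF v])
  have 1: "continuous_on (rfib H v) (\<lambda>a. h (InH a))"
    by (rule continuous_on_eq[OF Cc_closed_embedding(1)[OF e(1,2)]]) (simp add: e(3))
  have 2: "continuous_on {w. rmap Zop w = v} (\<lambda>w. h (InOp w))"
    by (rule continuous_on_eq[OF Cc_closed_embedding(1)[OF d(1,2)]]) (rule d(3)[symmetric], erule CollectD)
  have 3: "set_integrable (\<beta> v) (rfib H v) (\<lambda>a. h (InH a))"
    using set_integrable_closed_embedding[OF D.N e(1,2)] e(3)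
    by (subst set_integrable_cong[OF refl refl e(3)])
  have 4: "set_integrable (Op.\<sigma> v) {w. rmap Zop w = v} (\<lambda>w. h (InOp w))"
    using set_integrable_closed_embedding[OF D.M d(1,2)]
    by (rule set_integrable_cong[THEN iffD1, OF refl refl, rotated]) (rule d(3)[symmetric], erule CollectD)
  have "(LINT x:rfib LG (InH v)|\<kappa> (InH v). h x) =
      (LINT w:{w. rmap Zop w = v}|Op.\<sigma> v. h (InOp w)) + (LINT a:rfib H v|\<beta> v. h (InH a))"
    unfolding rfib_LG kappa_InH[OF v]
    by (rule D.set_integral_glue[OF Op.closed_fibre 2 4 H.closed_rfib 1 3])
  also have "(LINT a:rfib H v|\<beta> v. h (InH a)) = (LINT a:rfib H v|\<beta> v. f (e a))"
    using e(3) H.closed_rfib D.sets_N by (intro set_lebesgue_integral_cong) auto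
  also have "(LINT w:{w. rmap Zop w = v}|Op.\<sigma> v. h (InOp w)) = (LINT w:{w. rmap Zop w = v}|Op.\<sigma> v. k (d w))"
  proof (rule set_lebesgue_integral_cong)
    show "{w. rmap Zop w = v} \<in> sets (Op.\<sigma> v)"
      unfolding D.sets_M by (rule borel_closed[OF Op.closed_fibre])
  qed (intro allI impI d(3), erule CollectD)
  finally show ?thesis .
qed

text \<open>
  Each case splits the integral over the two pieces of the fibre. Integrability of the pieces, which
  the splitting needs, holds because on each piece the integrand is a function in \<open>C\<^sub>c\<close> composed with a
  closed embedding: a translation, an orbit map, or a bracket.\<close>

lemma kappa_invariant:
  assumes F: "F \<in> Cc"
  shows "(LINT y:rfib LG (src LG x)|\<kappa> (src LG x). F (mul LG x y)) = (\<integral>y. F y \<partial>\<kappa> (rng LG x))"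
proof (cases x)
  case (InG g)
  note u = G.src_in_units[of g]
  obtain z where z: "rmap Z z = src G g" using u R.range_rmap by (metis imageE)
  have "(LINT y:rfib LG (InG (src G g))|\<kappa> (InG (src G g)). F (link_mul G H Z (InG g) y)) =
      (LINT a:rfib G (src G g)|\<alpha> (src G g). F (InG (mul G g a))) +
      (LINT z:{z. rmap Z z = src G g}|R.\<sigma> (src G g). F (InZ (lact Z g z)))"
    by (rule set_integral_kappa_G[OF u G.translation_embedding Cc_pieces(1)[OF F] _ lact_embedding Cc_pieces(2)[OF F]])
      simp_all
  also have "(LINT a:rfib G (src G g)|\<alpha> (src G g). F (InG (mul G g a))) = (\<integral>a. F (InG a) \<partial>\<alpha> (rng G g))"
    by (rule haar_system_invariant[OF haar_G Cc_pieces(1)[OF F]])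
  also have "(LINT z:{z. rmap Z z = src G g}|R.\<sigma> (src G g). F (InZ (lact Z g z))) = (\<integral>z. F (InZ z) \<partial>R.\<sigma> (rng G g))"
    unfolding z[symmetric] using z closed_embeddingD(3)[OF lact_embedding[of g]]
    by (intro R.sigma_equivariant Cc_pieces(2) F) (simp_all add: rmap_lact smap_lact actions_commute)
  finally show ?thesis using InG integral_kappa(1)[OF F G.rng_in_units[of g]] by simp
next
  case (InZ z)
  note v = smap_in_units[of z]
  have z: "rmap Zop (Bar z) = smap Z z" "smap Zop (Bar z) = rmap Z z" by simp_all
  have "(LINT y:rfib LG (InH (smap Z z))|\<kappa> (InH (smap Z z)). F (link_mul G H Z (InZ z) y)) =
      (LINT w:{w. rmap Zop w = smap Z z}|Op.\<sigma> (smap Z z). F (InG (rbracket G Zop (Bar z) w))) +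
      (LINT a:rfib H (smap Z z)|\<beta> (smap Z z). F (InZ (ract Z z a)))"
    by (rule set_integral_kappa_H[OF v Op.rbracket_embedding[of "Bar z", unfolded z] Cc_pieces(1)[OF F] _
          R.orbit_embedding Cc_pieces(2)[OF F]])
      (simp_all add: lbracket_eq_rbracket_opp)
  also have "(LINT w:{w. rmap Zop w = smap Z z}|Op.\<sigma> (smap Z z). F (InG (rbracket G Zop (Bar z) w))) =
      (\<integral>a. F (InG a) \<partial>\<alpha> (rmap Z z))"
    by (rule Op.sigma_rbracket[of _ "Bar z", unfolded z, OF Cc_pieces(1)[OF F]])
  also have "(LINT a:rfib H (smap Z z)|\<beta> (smap Z z). F (InZ (ract Z z a))) = (\<integral>y. F (InZ y) \<partial>R.\<sigma> (rmap Z z))"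
    by (rule R.integral_sigma[OF Cc_pieces(2)[OF F], symmetric])
  finally show ?thesis using InZ integral_kappa(1)[OF F rmap_in_units[of z]] by simp
next
  case (InOp w)
  define z where "z = unbar w"
  have w: "w = Bar z" "rmap Zop w = smap Z z" "smap Zop w = rmap Z z" by (simp_all add: z_def)
  note u = rmap_in_units[of z]
  have "(LINT y:rfib LG (InG (rmap Z z))|\<kappa> (InG (rmap Z z)). F (link_mul G H Z (InOp w) y)) =
      (LINT a:rfib G (rmap Z z)|\<alpha> (rmap Z z). F (InOp (ract Zop w a))) +
      (LINT y:{y. rmap Z y = rmap Z z}|R.\<sigma> (rmap Z z). F (InH (rbracket H Z z y)))"
    by (rule set_integral_kappa_G[OF u Op.orbit_embedding[of w, unfolded w(3)] Cc_pieces(3)[OF F] _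
          R.rbracket_embedding Cc_pieces(4)[OF F]])
      (simp_all add: z_def)
  also have "(LINT a:rfib G (rmap Z z)|\<alpha> (rmap Z z). F (InOp (ract Zop w a))) = (\<integral>y. F (InOp y) \<partial>Op.\<sigma> (smap Z z))"
    by (rule Op.integral_sigma[OF Cc_pieces(3)[OF F], of w, unfolded w(2,3), symmetric])
  also have "(LINT y:{y. rmap Z y = rmap Z z}|R.\<sigma> (rmap Z z). F (InH (rbracket H Z z y))) = (\<integral>a. F (InH a) \<partial>\<beta> (smap Z z))"
    by (rule R.sigma_rbracket[OF Cc_pieces(4)[OF F]])
  finally show ?thesis using InOp integral_kappa(2)[OF F smap_in_units[of z]] by (simp add: z_def)
next
  case (InH y)
  note v = H.src_in_units[of y]
  obtain w where w: "rmap Zop w = src H y" using v Op.range_rmap by (metis imageE)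
  have "(LINT x:rfib LG (InH (src H y))|\<kappa> (InH (src H y)). F (link_mul G H Z (InH y) x)) =
      (LINT w:{w. rmap Zop w = src H y}|Op.\<sigma> (src H y). F (InOp (lact Zop y w))) +
      (LINT a:rfib H (src H y)|\<beta> (src H y). F (InH (mul H y a)))"
    by (rule set_integral_kappa_H[OF v lact_opp_embedding Cc_pieces(3)[OF F] _ H.translation_embedding Cc_pieces(4)[OF F]])
      simp_all
  also have "(LINT a:rfib H (src H y)|\<beta> (src H y). F (InH (mul H y a))) = (\<integral>a. F (InH a) \<partial>\<beta> (rng H y))"
    by (rule haar_system_invariant[OF haar_H Cc_pieces(4)[OF F]])
  also have "(LINT w:{w. rmap Zop w = src H y}|Op.\<sigma> (src H y). F (InOp (lact Zop y w))) = (\<integral>w. F (InOp w) \<partial>Op.\<sigma> (rng H y))"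
    unfolding w[symmetric]
  proof (rule Op.sigma_equivariant[where T = "lact Zop y" and f = "\<lambda>w. F (InOp w)", OF _ _ _ _ Cc_pieces(3)[OF F]])
    show "continuous_on {w'. rmap Zop w' = rmap Zop w} (lact Zop y)"
      using closed_embeddingD(3)[OF lact_opp_embedding[of y]] unfolding w .
  qed (use w in \<open>simp_all add: smap_ract rmap_ract actions_commute H.rng_inv H.src_inv G.src_inv\<close>)
  finally show ?thesis using InH integral_kappa(2)[OF F H.rng_in_units[of y]] by simp
qed

lemma haar_system_kappa: "haar_system LG \<kappa>"
  unfolding haar_system_def using kappa_radon_msupp continuous_kappa kappa_invariant by blast

end

theorem lemma4:
  fixes G :: "'g::{second_countable_topology, t2_space} groupoid"
    and H :: "'h::{second_countable_topology, t2_space} groupoid"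
    and Z :: "('g, 'z::{second_countable_topology, t2_space}, 'h) bispace"
    and \<alpha> :: "'g \<Rightarrow> 'g measure"
    and \<beta> :: "'h \<Rightarrow> 'h measure"
  assumes "lch_groupoid G" and "lch_groupoid H"
    and "haar_system G \<alpha>" and "haar_system H \<beta>"
    and "groupoid_equivalence G H Z"
  shows "haar_system (linking_groupoid G H Z) (kappa G H Z \<alpha> \<beta>)"
proof -
  interpret equivalence_haar G H Z \<alpha> \<beta>
    using assms by (intro equivalence_haar.intro equivalence_haar_axioms.intro)
  show ?thesis by (rule haar_system_kappa)
qed

end
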